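(* Every typed term is strongly normalizable: if $\Gamma \vdash M : A$ is derivable in the typing system described in the context, then there is no infinite sequence $M \triangleright M_1 \triangleright M_2 \triangleright \cdots$.
   Context: Formulas are built from propositional atoms and $\perp$ with the connectives $\rightarrow$, $\wedge$, $\vee$; $\neg A$ abbreviates $A \rightarrow \perp$. There are intuitionistic variables $x,y,\dots$ and classical variables $a,b,\dots$. Terms ${\cal T}$ and eliminators ${\cal E}$ are given by ${\cal T} ::= x \mid \lambda x\, {\cal T} \mid ({\cal T}\ {\cal E}) \mid \langle {\cal T},{\cal T}\rangle \mid \omega_1 {\cal T} \mid \omega_2 {\cal T} \mid \mu a\, {\cal T} \mid (a\ {\cal T})$ and ${\cal E} ::= {\cal T} \mid \pi_1 \mid \pi_2 \mid [x.{\cal T}, y.{\cal T}]$; $(M\ N_1 \dots N_n)$ means $((M\ N_1)\dots N_n)$. A context $\Gamma$ is a set of declarations $x : A$ and $a : \neg A$. Typing rules: $\Gamma, x:A \vdash x : A$; from $\Gamma_1 \vdash M:A$ and $\Gamma_2 \vdash N:B$ infer $\Gamma_1,\Gamma_2 \vdash \langle M,N\rangle : A\wedge B$; from $\Gamma \vdash M : A_1\wedge A_2$ infer $\Gamma \vdash (M\ \pi_i):A_i$; from $\Gamma,x:A\vdash M:B$ infer $\Gamma\vdash \lambda x M : A\rightarrow B$; from $\Gamma_1\vdash M:A\rightarrow B$ and $\Gamma_2 \vdash N:A$ infer $\Gamma_1,\Gamma_2\vdash (M\ N):B$; from $\Gamma\vdash M:A_i$ infer $\Gamma \vdash \omega_i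 M : A_1\vee A_2$; from $\Gamma\vdash M:A_1\vee A_2$, $\Gamma_1,x_1:A_1\vdash N_1:C$, $\Gamma_2,x_2:A_2\vdash N_2:C$ infer $\Gamma,\Gamma_1,\Gamma_2\vdash (M\ [x_1.N_1,x_2.N_2]):C$; from $\Gamma,a:\neg A\vdash M:\perp$ infer $\Gamma\vdash \mu a M : A$; from $\Gamma, a:\neg A\vdash M:A$ infer $\Gamma\vdash (a\ M):\perp$. A term is typed if it has a type in some context. The one-step reduction $\triangleright$ is the compatible closure (reduction allowed inside any subterm, including inside the branches of $[x.N_1,y.N_2]$) of: $(\lambda x M\ N)\triangleright M[x:=N]$; $(\langle M_1,M_2\rangle\ \pi_i)\triangleright M_i$; $(\omega_i M\ [x_1.N_1,x_2.N_2])\triangleright N_i[x_i:=M]$; $(M\ [x_1.N_1,x_2.N_2]\ \varepsilon)\triangleright (M\ [x_1.(N_1\ \varepsilon),x_2.(N_2\ \varepsilon)])$; $(\mu a M\ \varepsilon)\triangleright \mu a\, M[a:=^*\varepsilon]$, where $M[a:=^*\varepsilon]$ is obtained by replacing (recursively) each subterm of $M$ of the form $(a\ N)$ by $(a\ (N\ \varepsilon))$. $\triangleright^+$ and $\triangleright^*$ are the transitive and reflexive-transitive closures. An element is strongly normalizable ($\in SN$) if there is no infinite $\triangleright$-reduction sequence starting from it.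
   Formalization: The typing rule for (a M) is taken as: from Γ, a:¬A ⊢ M:A infer Γ, a:¬A ⊢ (a M):⊥, keeping the declaration of a; with a discharged as literally written, the non-normalizing term (δ δ), δ = λx(μa(z (a x)) x), would be typable. *)

theory Defs
  imports Main
begin

text \<open>
  Terms are represented up to renaming of bound variables by de Bruijn indices. Intuitionistic and
  classical variables are numbered independently of each other: the \<open>\<lambda>\<close>-abstraction and the two
  branches of a case eliminator bind the intuitionistic index 0, the \<open>\<mu>\<close>-abstraction binds the
  classical index 0.
\<close>

datatype 'p form =
    Atom 'p
  | Bot
  | Imp "'p form" "'p form"
  | Conj "'p form" "'p form"
  | Disj "'p form" "'p form"

text \<open>
  \<open>Named a M\<close> is \<open>(a M)\<close>. Every term is an eliminator; the inclusion is the constructor \<open>Arg\<close>.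
  \<open>Case N1 N2\<close> is \<open>[x.N1, y.N2]\<close>.
\<close>

datatype trm =
    Var nat
  | Lam trm
  | App trm elim
  | Pair trm trm
  | Inj1 trm
  | Inj2 trm
  | Mu trm
  | Named nat trm
and elim =
    Arg trm
  | Pi1
  | Pi2
  | Case trm trm

text \<open>Raising by one the intuitionistic indices that are at least \<open>k\<close>.\<close>

primrec lift :: "trm \<Rightarrow> nat \<Rightarrow> trm" and lift_elim :: "elim \<Rightarrow> nat \<Rightarrow> elim" where
  "lift (Var i) k = Var (if i < k then i else Suc i)"
| "lift (Lam M) k = Lam (lift M (Suc k))"
| "lift (App M e) k = App (lift M k) (lift_elim e k)"
| "lift (Pair M N) k = Pair (lift M k) (lift N k)"
| "lift (Inj1 M) k = Inj1 (lift M k)"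
| "lift (Inj2 M) k = Inj2 (lift M k)"
| "lift (Mu M) k = Mu (lift M k)"
| "lift (Named a M) k = Named a (lift M k)"
| "lift_elim (Arg N) k = Arg (lift N k)"
| "lift_elim Pi1 k = Pi1"
| "lift_elim Pi2 k = Pi2"
| "lift_elim (Case N1 N2) k = Case (lift N1 (Suc k)) (lift N2 (Suc k))"

text \<open>Raising by one the classical indices that are at least \<open>k\<close>.\<close>

primrec clift :: "trm \<Rightarrow> nat \<Rightarrow> trm" and clift_elim :: "elim \<Rightarrow> nat \<Rightarrow> elim" where
  "clift (Var i) k = Var i"
| "clift (Lam M) k = Lam (clift M k)"
| "clift (App M e) k = App (clift M k) (clift_elim e k)"
| "clift (Pair M N) k = Pair (clift M k) (clift N k)"
| "clift (Inj1 M) k = Inj1 (clift M k)"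
| "clift (Inj2 M) k = Inj2 (clift M k)"
| "clift (Mu M) k = Mu (clift M (Suc k))"
| "clift (Named a M) k = Named (if a < k then a else Suc a) (clift M k)"
| "clift_elim (Arg N) k = Arg (clift N k)"
| "clift_elim Pi1 k = Pi1"
| "clift_elim Pi2 k = Pi2"
| "clift_elim (Case N1 N2) k = Case (clift N1 k) (clift N2 k)"

text \<open>
  \<open>subst M P k\<close> is \<open>M[x:=P]\<close> for the intuitionistic variable \<open>x\<close> with index \<open>k\<close>. Its binder
  disappears, so the intuitionistic indices above \<open>k\<close> are lowered by one.
\<close>

primrec subst :: "trm \<Rightarrow> trm \<Rightarrow> nat \<Rightarrow> trm" and subst_elim :: "elim \<Rightarrow> trm \<Rightarrow> nat \<Rightarrow> elim" where
  "subst (Var i) P k = (if i < k then Var i else if i = k then P else Var (i - 1))"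
| "subst (Lam M) P k = Lam (subst M (lift P 0) (Suc k))"
| "subst (App M e) P k = App (subst M P k) (subst_elim e P k)"
| "subst (Pair M N) P k = Pair (subst M P k) (subst N P k)"
| "subst (Inj1 M) P k = Inj1 (subst M P k)"
| "subst (Inj2 M) P k = Inj2 (subst M P k)"
| "subst (Mu M) P k = Mu (subst M (clift P 0) k)"
| "subst (Named a M) P k = Named a (subst M P k)"
| "subst_elim (Arg N) P k = Arg (subst N P k)"
| "subst_elim Pi1 P k = Pi1"
| "subst_elim Pi2 P k = Pi2"
| "subst_elim (Case N1 N2) P k =
     Case (subst N1 (lift P 0) (Suc k)) (subst N2 (lift P 0) (Suc k))"

text \<open>
  \<open>csubst M \<epsilon> k\<close> is \<open>M[a:=\<^sup>*\<epsilon>]\<close> for the classical variable \<open>a\<close> with index \<open>k\<close>. Here \<open>a\<close> persists,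
  so no index is lowered, and \<open>\<epsilon>\<close> has to be given in the scope of \<open>a\<close>.
\<close>

primrec csubst :: "trm \<Rightarrow> elim \<Rightarrow> nat \<Rightarrow> trm" and csubst_elim :: "elim \<Rightarrow> elim \<Rightarrow> nat \<Rightarrow> elim" where
  "csubst (Var i) \<epsilon> k = Var i"
| "csubst (Lam M) \<epsilon> k = Lam (csubst M (lift_elim \<epsilon> 0) k)"
| "csubst (App M e) \<epsilon> k = App (csubst M \<epsilon> k) (csubst_elim e \<epsilon> k)"
| "csubst (Pair M N) \<epsilon> k = Pair (csubst M \<epsilon> k) (csubst N \<epsilon> k)"
| "csubst (Inj1 M) \<epsilon> k = Inj1 (csubst M \<epsilon> k)"
| "csubst (Inj2 M) \<epsilon> k = Inj2 (csubst M \<epsilon> k)"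
| "csubst (Mu M) \<epsilon> k = Mu (csubst M (clift_elim \<epsilon> 0) (Suc k))"
| "csubst (Named a M) \<epsilon> k =
     (if a = k then Named a (App (csubst M \<epsilon> k) \<epsilon>) else Named a (csubst M \<epsilon> k))"
| "csubst_elim (Arg N) \<epsilon> k = Arg (csubst N \<epsilon> k)"
| "csubst_elim Pi1 \<epsilon> k = Pi1"
| "csubst_elim Pi2 \<epsilon> k = Pi2"
| "csubst_elim (Case N1 N2) \<epsilon> k =
     Case (csubst N1 (lift_elim \<epsilon> 0) k) (csubst N2 (lift_elim \<epsilon> 0) k)"

inductive red :: "trm \<Rightarrow> trm \<Rightarrow> bool" (infix "\<triangleright>" 50)
  and red_elim :: "elim \<Rightarrow> elim \<Rightarrow> bool" (infix "\<triangleright>\<^sub>e" 50) where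
  beta: "App (Lam M) (Arg N) \<triangleright> subst M N 0"
| proj1: "App (Pair M1 M2) Pi1 \<triangleright> M1"
| proj2: "App (Pair M1 M2) Pi2 \<triangleright> M2"
| case1: "App (Inj1 M) (Case N1 N2) \<triangleright> subst N1 M 0"
| case2: "App (Inj2 M) (Case N1 N2) \<triangleright> subst N2 M 0"
| perm: "App (App M (Case N1 N2)) \<epsilon> \<triangleright>
    App M (Case (App N1 (lift_elim \<epsilon> 0)) (App N2 (lift_elim \<epsilon> 0)))"
| mu: "App (Mu M) \<epsilon> \<triangleright> Mu (csubst M (clift_elim \<epsilon> 0) 0)"
| Lam: "M \<triangleright> M' \<Longrightarrow> Lam M \<triangleright> Lam M'"
| App_fun: "M \<triangleright> M' \<Longrightarrow> App M \<epsilon> \<triangleright> App M' \<epsilon>"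
| App_elim: "\<epsilon> \<triangleright>\<^sub>e \<epsilon>' \<Longrightarrow> App M \<epsilon> \<triangleright> App M \<epsilon>'"
| Pair_fst: "M \<triangleright> M' \<Longrightarrow> Pair M N \<triangleright> Pair M' N"
| Pair_snd: "N \<triangleright> N' \<Longrightarrow> Pair M N \<triangleright> Pair M N'"
| Inj1: "M \<triangleright> M' \<Longrightarrow> Inj1 M \<triangleright> Inj1 M'"
| Inj2: "M \<triangleright> M' \<Longrightarrow> Inj2 M \<triangleright> Inj2 M'"
| Mu: "M \<triangleright> M' \<Longrightarrow> Mu M \<triangleright> Mu M'"
| Named: "M \<triangleright> M' \<Longrightarrow> Named a M \<triangleright> Named a M'"
| Arg: "N \<triangleright> N' \<Longrightarrow> Arg N \<triangleright>\<^sub>e Arg N'"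
| Case_left: "N1 \<triangleright> N1' \<Longrightarrow> Case N1 N2 \<triangleright>\<^sub>e Case N1' N2"
| Case_right: "N2 \<triangleright> N2' \<Longrightarrow> Case N1 N2 \<triangleright>\<^sub>e Case N1 N2'"

text \<open>
  A context is split into its intuitionistic part \<open>\<Gamma>\<close> and its classical part \<open>\<Delta>\<close>, each declaring
  every variable at most once. \<open>\<Gamma> x = Some A\<close> is the declaration \<open>x : A\<close>, whereas \<open>\<Delta> a = Some A\<close> is
  the declaration \<open>a : \<not>A\<close> (the negation is implicit).
\<close>

type_synonym 'p decls = "nat \<Rightarrow> 'p form option"

text \<open>Declaring the variable with index 0 moves the other declarations up by one.\<close>

definition extend :: "'p form \<Rightarrow> 'p decls \<Rightarrow> 'p decls" where
  "extend A \<Gamma> = case_nat (Some A) \<Gamma>"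

text \<open>
  The union of two contexts is a context only if they agree on the variables they share;
  in this case it is given by \<open>(++)\<close>.
\<close>

definition compatible :: "'p decls \<Rightarrow> 'p decls \<Rightarrow> bool" where
  "compatible \<Gamma>1 \<Gamma>2 \<longleftrightarrow> (\<forall>x \<in> dom \<Gamma>1 \<inter> dom \<Gamma>2. \<Gamma>1 x = \<Gamma>2 x)"

inductive typing :: "'p decls \<Rightarrow> 'p decls \<Rightarrow> trm \<Rightarrow> 'p form \<Rightarrow> bool"
    ("_ \<parallel> _ \<turnstile> _ : _" [50, 50, 50, 50] 50) where
  Var: "\<Gamma> x = Some A \<Longrightarrow> \<Gamma> \<parallel> \<Delta> \<turnstile> Var x : A"
| Pair: "\<lbrakk> \<Gamma>1 \<parallel> \<Delta>1 \<turnstile> M : A; \<Gamma>2 \<parallel> \<Delta>2 \<turnstile> N : B; compatible \<Gamma>1 \<Gamma>2; compatible \<Delta>1 \<Delta>2 \<rbrakk>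
    \<Longrightarrow> \<Gamma>1 ++ \<Gamma>2 \<parallel> \<Delta>1 ++ \<Delta>2 \<turnstile> Pair M N : Conj A B"
| Pi1: "\<Gamma> \<parallel> \<Delta> \<turnstile> M : Conj A1 A2 \<Longrightarrow> \<Gamma> \<parallel> \<Delta> \<turnstile> App M Pi1 : A1"
| Pi2: "\<Gamma> \<parallel> \<Delta> \<turnstile> M : Conj A1 A2 \<Longrightarrow> \<Gamma> \<parallel> \<Delta> \<turnstile> App M Pi2 : A2"
| Lam: "extend A \<Gamma> \<parallel> \<Delta> \<turnstile> M : B \<Longrightarrow> \<Gamma> \<parallel> \<Delta> \<turnstile> Lam M : Imp A B"
| Arg: "\<lbrakk> \<Gamma>1 \<parallel> \<Delta>1 \<turnstile> M : Imp A B; \<Gamma>2 \<parallel> \<Delta>2 \<turnstile> N : A; compatible \<Gamma>1 \<Gamma>2; compatible \<Delta>1 \<Delta>2 \<rbrakk>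
    \<Longrightarrow> \<Gamma>1 ++ \<Gamma>2 \<parallel> \<Delta>1 ++ \<Delta>2 \<turnstile> App M (Arg N) : B"
| Inj1: "\<Gamma> \<parallel> \<Delta> \<turnstile> M : A1 \<Longrightarrow> \<Gamma> \<parallel> \<Delta> \<turnstile> Inj1 M : Disj A1 A2"
| Inj2: "\<Gamma> \<parallel> \<Delta> \<turnstile> M : A2 \<Longrightarrow> \<Gamma> \<parallel> \<Delta> \<turnstile> Inj2 M : Disj A1 A2"
| Case: "\<lbrakk> \<Gamma> \<parallel> \<Delta> \<turnstile> M : Disj A1 A2;
      extend A1 \<Gamma>1 \<parallel> \<Delta>1 \<turnstile> N1 : C; extend A2 \<Gamma>2 \<parallel> \<Delta>2 \<turnstile> N2 : C;
      compatible \<Gamma> \<Gamma>1; compatible \<Gamma> \<Gamma>2; compatible \<Gamma>1 \<Gamma>2;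
      compatible \<Delta> \<Delta>1; compatible \<Delta> \<Delta>2; compatible \<Delta>1 \<Delta>2 \<rbrakk>
    \<Longrightarrow> \<Gamma> ++ \<Gamma>1 ++ \<Gamma>2 \<parallel> \<Delta> ++ \<Delta>1 ++ \<Delta>2 \<turnstile> App M (Case N1 N2) : C"
| Mu: "\<Gamma> \<parallel> extend A \<Delta> \<turnstile> M : Bot \<Longrightarrow> \<Gamma> \<parallel> \<Delta> \<turnstile> Mu M : A"
| Named: "\<lbrakk> \<Delta> a = Some A; \<Gamma> \<parallel> \<Delta> \<turnstile> M : A \<rbrakk> \<Longrightarrow> \<Gamma> \<parallel> \<Delta> \<turnstile> Named a M : Bot"

definition strongly_normalizable :: "('e \<Rightarrow> 'e \<Rightarrow> bool) \<Rightarrow> 'e \<Rightarrow> bool" where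
  "strongly_normalizable R M \<longleftrightarrow> \<not> (\<exists>f :: nat \<Rightarrow> 'e. f 0 = M \<and> (\<forall>i. R (f i) (f (Suc i))))"

end

theory Submission
  imports Defs
begin

text \<open>
  A formula is interpreted by a set of stacks, that is, of sequences of eliminators, and the
  candidate of the formula consists of the terms that are strongly normalizable when applied to any
  of these stacks. Since \<open>\<mu>\<close>-reduction only moves eliminators to the occurrences of the bound
  classical variable, \<open>(\<mu>a M \<epsilon>\<^sub>1 \<dots> \<epsilon>\<^sub>n)\<close> is strongly normalizable as soon as
  \<open>M[a:=\<^sup>*\<epsilon>\<^sub>1]\<dots>[a:=\<^sup>*\<epsilon>\<^sub>n]\<close> and the stack are; hence classical variables are interpreted by stacks and
  a typed term stays in the candidate of its type under every adequate substitution.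

  The stacks of a disjunction are the \<open>[x.N1, y.N2] \<epsilon>\<^sub>1 \<dots> \<epsilon>\<^sub>n\<close> for which \<open>(N1[x:=P] \<epsilon>\<^sub>1 \<dots> \<epsilon>\<^sub>n)\<close> and
  \<open>(N2[y:=Q] \<epsilon>\<^sub>1 \<dots> \<epsilon>\<^sub>n)\<close> are strongly normalizable for all \<open>P\<close>, \<open>Q\<close> in the two candidates. With this
  choice permutative conversions only have to be analysed inside a stack, where they cannot
  interfere with the term the stack is applied to.
\<close>

subsection \<open>Renaming and parallel substitution\<close>

definition up :: "(nat \<Rightarrow> nat) \<Rightarrow> nat \<Rightarrow> nat" where
  "up \<xi> = case_nat 0 (\<lambda>i. Suc (\<xi> i))"

lemma up_simps [simp]: "up \<xi> 0 = 0" "up \<xi> (Suc i) = Suc (\<xi> i)"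
  by (simp_all add: up_def)

text \<open>Both kinds of indices are renamed at once, by arbitrary functions. Injectivity is not
  demanded, so a renaming may also identify names, which is used later to cancel a lifting.\<close>

primrec ren :: "trm \<Rightarrow> (nat \<Rightarrow> nat) \<Rightarrow> (nat \<Rightarrow> nat) \<Rightarrow> trm"
  and ren_elim :: "elim \<Rightarrow> (nat \<Rightarrow> nat) \<Rightarrow> (nat \<Rightarrow> nat) \<Rightarrow> elim" where
  "ren (Var i) \<xi> \<zeta> = Var (\<xi> i)"
| "ren (Lam M) \<xi> \<zeta> = Lam (ren M (up \<xi>) \<zeta>)"
| "ren (App M e) \<xi> \<zeta> = App (ren M \<xi> \<zeta>) (ren_elim e \<xi> \<zeta>)"
| "ren (Pair M N) \<xi> \<zeta> = Pair (ren M \<xi> \<zeta>) (ren N \<xi> \<zeta>)"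
| "ren (Inj1 M) \<xi> \<zeta> = Inj1 (ren M \<xi> \<zeta>)"
| "ren (Inj2 M) \<xi> \<zeta> = Inj2 (ren M \<xi> \<zeta>)"
| "ren (Mu M) \<xi> \<zeta> = Mu (ren M \<xi> (up \<zeta>))"
| "ren (Named a M) \<xi> \<zeta> = Named (\<zeta> a) (ren M \<xi> \<zeta>)"
| "ren_elim (Arg N) \<xi> \<zeta> = Arg (ren N \<xi> \<zeta>)"
| "ren_elim Pi1 \<xi> \<zeta> = Pi1"
| "ren_elim Pi2 \<xi> \<zeta> = Pi2"
| "ren_elim (Case N1 N2) \<xi> \<zeta> = Case (ren N1 (up \<xi>) \<zeta>) (ren N2 (up \<xi>) \<zeta>)"

abbreviation app_stack :: "trm \<Rightarrow> elim list \<Rightarrow> trm" (infixl "\<star>" 65) where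
  "M \<star> \<pi> \<equiv> foldl App M \<pi>"

abbreviation ren_stack :: "elim list \<Rightarrow> (nat \<Rightarrow> nat) \<Rightarrow> (nat \<Rightarrow> nat) \<Rightarrow> elim list" where
  "ren_stack \<pi> \<xi> \<zeta> \<equiv> map (\<lambda>e. ren_elim e \<xi> \<zeta>) \<pi>"

type_synonym isub = "nat \<Rightarrow> trm"
type_synonym csub = "nat \<Rightarrow> nat \<times> elim list"

text \<open>\<open>ups\<close> and \<open>upr\<close> pass an intuitionistic binder,
  \<open>cups\<close> and \<open>cupr\<close> a classical one. Terms and stacks contain indices of
  both kinds, so either binder affects both components.\<close>

definition ups :: "isub \<Rightarrow> isub" where
  "ups \<sigma> = case_nat (Var 0) (\<lambda>i. ren (\<sigma> i) Suc id)"

definition upr :: "csub \<Rightarrow> csub" where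
  "upr \<rho> = (\<lambda>a. (fst (\<rho> a), ren_stack (snd (\<rho> a)) Suc id))"

definition cups :: "isub \<Rightarrow> isub" where
  "cups \<sigma> = (\<lambda>i. ren (\<sigma> i) id Suc)"

definition cupr :: "csub \<Rightarrow> csub" where
  "cupr \<rho> = case_nat (0, []) (\<lambda>a. (Suc (fst (\<rho> a)), ren_stack (snd (\<rho> a)) id Suc))"

text \<open>
  A classical variable \<open>a\<close> is mapped to a name \<open>b\<close> together with a stack \<open>\<pi>\<close>, meaning that \<open>(a M)\<close>
  becomes \<open>(b (M \<pi>))\<close>. Renaming, \<open>subst\<close> and \<open>csubst\<close> are all instances of this operation.
\<close>

primrec psub :: "trm \<Rightarrow> isub \<Rightarrow> csub \<Rightarrow> trm" and psub_elim :: "elim \<Rightarrow> isub \<Rightarrow> csub \<Rightarrow> elim" where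
  "psub (Var i) \<sigma> \<rho> = \<sigma> i"
| "psub (Lam M) \<sigma> \<rho> = Lam (psub M (ups \<sigma>) (upr \<rho>))"
| "psub (App M e) \<sigma> \<rho> = App (psub M \<sigma> \<rho>) (psub_elim e \<sigma> \<rho>)"
| "psub (Pair M N) \<sigma> \<rho> = Pair (psub M \<sigma> \<rho>) (psub N \<sigma> \<rho>)"
| "psub (Inj1 M) \<sigma> \<rho> = Inj1 (psub M \<sigma> \<rho>)"
| "psub (Inj2 M) \<sigma> \<rho> = Inj2 (psub M \<sigma> \<rho>)"
| "psub (Mu M) \<sigma> \<rho> = Mu (psub M (cups \<sigma>) (cupr \<rho>))"
| "psub (Named a M) \<sigma> \<rho> = Named (fst (\<rho> a)) (psub M \<sigma> \<rho> \<star> snd (\<rho> a))"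
| "psub_elim (Arg N) \<sigma> \<rho> = Arg (psub N \<sigma> \<rho>)"
| "psub_elim Pi1 \<sigma> \<rho> = Pi1"
| "psub_elim Pi2 \<sigma> \<rho> = Pi2"
| "psub_elim (Case N1 N2) \<sigma> \<rho> =
     Case (psub N1 (ups \<sigma>) (upr \<rho>)) (psub N2 (ups \<sigma>) (upr \<rho>))"

abbreviation psub_stack :: "elim list \<Rightarrow> isub \<Rightarrow> csub \<Rightarrow> elim list" where
  "psub_stack \<pi> \<sigma> \<rho> \<equiv> map (\<lambda>e. psub_elim e \<sigma> \<rho>) \<pi>"

abbreviation idc :: csub where
  "idc \<equiv> \<lambda>a. (a, [])"

lemma ren_app_stack [simp]: "ren (M \<star> \<pi>) \<xi> \<zeta> = ren M \<xi> \<zeta> \<star> ren_stack \<pi> \<xi> \<zeta>"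
  by (induction \<pi> arbitrary: M) auto

lemma psub_app_stack [simp]: "psub (M \<star> \<pi>) \<sigma> \<rho> = psub M \<sigma> \<rho> \<star> psub_stack \<pi> \<sigma> \<rho>"
  by (induction \<pi> arbitrary: M) auto

section \<open>Composition laws for renaming and parallel substitution\<close>

lemma up_comp: "up \<xi>' \<circ> up \<xi> = up (\<xi>' \<circ> \<xi>)"
  by (rule ext) (simp add: up_def split: nat.split)

lemma up_id [simp]: "up id = id"
  by (rule ext) (simp add: up_def split: nat.split)

lemma up_Suc: "up \<xi> \<circ> Suc = Suc \<circ> \<xi>"
  by auto

lemma ren_ren:
  "ren (ren M \<xi> \<zeta>) \<xi>' \<zeta>' = ren M (\<xi>' \<circ> \<xi>) (\<zeta>' \<circ> \<zeta>)"
  "ren_elim (ren_elim e \<xi> \<zeta>) \<xi>' \<zeta>' = ren_elim e (\<xi>' \<circ> \<xi>) (\<zeta>' \<circ> \<zeta>)"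
  by (induction M and e arbitrary: \<xi> \<zeta> \<xi>' \<zeta>' and \<xi> \<zeta> \<xi>' \<zeta>') (simp_all add: up_comp)

lemma ups_comp_up: "ups \<sigma> \<circ> up \<xi> = ups (\<sigma> \<circ> \<xi>)"
  by (rule ext) (simp add: ups_def up_def split: nat.split)

lemma cupr_comp_up: "cupr \<rho> \<circ> up \<zeta> = cupr (\<rho> \<circ> \<zeta>)"
  by (rule ext) (simp add: cupr_def up_def split: nat.split)

lemma upr_comp: "upr \<rho> \<circ> \<zeta> = upr (\<rho> \<circ> \<zeta>)"
  by (simp add: upr_def comp_def)

lemma cups_comp: "cups \<sigma> \<circ> \<xi> = cups (\<sigma> \<circ> \<xi>)"
  by (simp add: cups_def comp_def)

lemma psub_ren:
  "psub (ren M \<xi> \<zeta>) \<sigma> \<rho> = psub M (\<sigma> \<circ> \<xi>) (\<rho> \<circ> \<zeta>)"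
  "psub_elim (ren_elim e \<xi> \<zeta>) \<sigma> \<rho> = psub_elim e (\<sigma> \<circ> \<xi>) (\<rho> \<circ> \<zeta>)"
  by (induction M and e arbitrary: \<xi> \<zeta> \<sigma> \<rho> and \<xi> \<zeta> \<sigma> \<rho>)
    (simp_all add: ups_comp_up cupr_comp_up upr_comp cups_comp)

definition ren_isub :: "isub \<Rightarrow> (nat \<Rightarrow> nat) \<Rightarrow> (nat \<Rightarrow> nat) \<Rightarrow> isub" where
  "ren_isub \<sigma> \<xi> \<zeta> = (\<lambda>i. ren (\<sigma> i) \<xi> \<zeta>)"

definition ren_csub :: "csub \<Rightarrow> (nat \<Rightarrow> nat) \<Rightarrow> (nat \<Rightarrow> nat) \<Rightarrow> csub" where
  "ren_csub \<rho> \<xi> \<zeta> = (\<lambda>a. (\<zeta> (fst (\<rho> a)), ren_stack (snd (\<rho> a)) \<xi> \<zeta>))"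

lemma ren_isub_ups: "ren_isub (ups \<sigma>) (up \<xi>) \<zeta> = ups (ren_isub \<sigma> \<xi> \<zeta>)"
  by (rule ext) (simp add: ren_isub_def ups_def ren_ren up_Suc split: nat.split)

lemma ren_csub_upr: "ren_csub (upr \<rho>) (up \<xi>) \<zeta> = upr (ren_csub \<rho> \<xi> \<zeta>)"
  by (simp add: ren_csub_def upr_def ren_ren up_Suc comp_def)

lemma ren_isub_cups: "ren_isub (cups \<sigma>) \<xi> (up \<zeta>) = cups (ren_isub \<sigma> \<xi> \<zeta>)"
  by (simp add: ren_isub_def cups_def ren_ren up_Suc)

lemma ren_csub_cupr: "ren_csub (cupr \<rho>) \<xi> (up \<zeta>) = cupr (ren_csub \<rho> \<xi> \<zeta>)"
  by (rule ext) (simp add: ren_csub_def cupr_def ren_ren up_Suc comp_def split: nat.split)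

lemma ren_psub:
  "ren (psub M \<sigma> \<rho>) \<xi> \<zeta> = psub M (ren_isub \<sigma> \<xi> \<zeta>) (ren_csub \<rho> \<xi> \<zeta>)"
  "ren_elim (psub_elim e \<sigma> \<rho>) \<xi> \<zeta> = psub_elim e (ren_isub \<sigma> \<xi> \<zeta>) (ren_csub \<rho> \<xi> \<zeta>)"
proof (induction M and e arbitrary: \<xi> \<zeta> \<sigma> \<rho> and \<xi> \<zeta> \<sigma> \<rho>)
\<comment> \<open>The first pass moves the renaming below the binders with the substitutions still
  folded, as the binder laws require; only then are they unfolded for variables and named
  terms.\<close>
qed (simp_all add: ren_isub_ups ren_csub_upr ren_isub_cups ren_csub_cupr,
     simp_all add: ren_isub_def ren_csub_def)

definition comp_isub :: "isub \<Rightarrow> isub \<Rightarrow> csub \<Rightarrow> isub" where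
  "comp_isub \<sigma> \<sigma>' \<rho>' = (\<lambda>i. psub (\<sigma> i) \<sigma>' \<rho>')"

text \<open>First \<open>(a M)\<close> becomes \<open>(b (M \<pi>))\<close>, then \<open>b\<close>
  receives \<open>\<kappa>\<close>. Hence \<open>\<pi>\<close>, itself substituted, stays next to
  the term and \<open>\<kappa>\<close> follows it.\<close>

definition comp_csub :: "csub \<Rightarrow> isub \<Rightarrow> csub \<Rightarrow> csub" where
  "comp_csub \<rho> \<sigma>' \<rho>' = (\<lambda>a. let (b, \<pi>) = \<rho> a; (c, \<kappa>) = \<rho>' b in (c, psub_stack \<pi> \<sigma>' \<rho>' @ \<kappa>))"

lemma ups_Suc: "ups \<sigma> \<circ> Suc = ren_isub \<sigma> Suc id"
  by (rule ext) (simp add: ups_def ren_isub_def)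

lemma upr_id: "upr \<rho> = ren_csub \<rho> Suc id"
  by (rule ext) (simp add: upr_def ren_csub_def)

lemma cups_id: "cups \<sigma> = ren_isub \<sigma> id Suc"
  by (rule ext) (simp add: cups_def ren_isub_def)

lemma cupr_Suc: "cupr \<rho> \<circ> Suc = ren_csub \<rho> id Suc"
  by (rule ext) (simp add: cupr_def ren_csub_def)

lemma cupr_simps: "cupr \<rho> 0 = (0, [])"
  "cupr \<rho> (Suc a) = (Suc (fst (\<rho> a)), ren_stack (snd (\<rho> a)) id Suc)"
  by (simp_all add: cupr_def)

lemma comp_isub_ups: "comp_isub (ups \<sigma>) (ups \<sigma>') (upr \<rho>') = ups (comp_isub \<sigma> \<sigma>' \<rho>')"
proof
  fix i show "comp_isub (ups \<sigma>) (ups \<sigma>') (upr \<rho>') i = ups (comp_isub \<sigma> \<sigma>' \<rho>') i"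
  proof (cases i)
    case 0 then show ?thesis by (simp add: comp_isub_def ups_def)
  next
    case (Suc j)
    have "comp_isub (ups \<sigma>) (ups \<sigma>') (upr \<rho>') i = psub (ren (\<sigma> j) Suc id) (ups \<sigma>') (upr \<rho>')"
      by (simp add: Suc comp_isub_def ups_def)
    also have "\<dots> = ups (comp_isub \<sigma> \<sigma>' \<rho>') i"
      by (simp add: psub_ren ups_Suc) (simp add: Suc comp_isub_def ups_def ren_psub upr_id)
    finally show ?thesis .
  qed
qed

lemma comp_isub_cups: "comp_isub (cups \<sigma>) (cups \<sigma>') (cupr \<rho>') = cups (comp_isub \<sigma> \<sigma>' \<rho>')"
proof
  fix i
  have "comp_isub (cups \<sigma>) (cups \<sigma>') (cupr \<rho>') i = psub (ren (\<sigma> i) id Suc) (cups \<sigma>') (cupr \<rho>')"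
    by (simp add: comp_isub_def cups_def)
  also have "\<dots> = cups (comp_isub \<sigma> \<sigma>' \<rho>') i"
    by (simp add: psub_ren cupr_Suc cups_id) (simp add: comp_isub_def ren_isub_def ren_psub)
  finally show "comp_isub (cups \<sigma>) (cups \<sigma>') (cupr \<rho>') i = cups (comp_isub \<sigma> \<sigma>' \<rho>') i" .
qed

lemma comp_csub_upr: "comp_csub (upr \<rho>) (ups \<sigma>') (upr \<rho>') = upr (comp_csub \<rho> \<sigma>' \<rho>')"
proof -
  have "psub_elim (ren_elim e Suc id) (ups \<sigma>') (upr \<rho>') = ren_elim (psub_elim e \<sigma>' \<rho>') Suc id" for e
    by (simp add: psub_ren ren_psub ups_Suc upr_id)
  then show ?thesis
    by (intro ext) (simp add: comp_csub_def upr_def split: prod.split)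
qed

lemma comp_csub_cupr: "comp_csub (cupr \<rho>) (cups \<sigma>') (cupr \<rho>') = cupr (comp_csub \<rho> \<sigma>' \<rho>')"
proof
  fix a
  have "psub_elim (ren_elim e id Suc) (cups \<sigma>') (cupr \<rho>') = ren_elim (psub_elim e \<sigma>' \<rho>') id Suc" for e
    by (simp add: psub_ren ren_psub cupr_Suc cups_id)
  then show "comp_csub (cupr \<rho>) (cups \<sigma>') (cupr \<rho>') a = cupr (comp_csub \<rho> \<sigma>' \<rho>') a"
    by (cases a) (simp_all add: comp_csub_def cupr_def split: prod.split)
qed

text \<open>At the binders this amounts to composition commuting with the four lifting operations,
  which rests on the mixed laws \<open>psub_ren\<close> and \<open>ren_psub\<close>.\<close>

lemma psub_psub:
  "psub (psub M \<sigma> \<rho>) \<sigma>' \<rho>' = psub M (comp_isub \<sigma> \<sigma>' \<rho>') (comp_csub \<rho> \<sigma>' \<rho>')"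
  "psub_elim (psub_elim e \<sigma> \<rho>) \<sigma>' \<rho>' = psub_elim e (comp_isub \<sigma> \<sigma>' \<rho>') (comp_csub \<rho> \<sigma>' \<rho>')"
proof (induction M and e arbitrary: \<sigma> \<rho> \<sigma>' \<rho>' and \<sigma> \<rho> \<sigma>' \<rho>')
qed (simp_all add: comp_isub_ups comp_isub_cups comp_csub_upr comp_csub_cupr,
     simp_all add: comp_isub_def comp_csub_def split: prod.split)

lemma ups_Var: "ups (\<lambda>i. Var (\<xi> i)) = (\<lambda>i. Var (up \<xi> i))"
  by (rule ext) (simp add: ups_def up_def split: nat.split)

lemma cupr_names: "cupr (\<lambda>a. (\<zeta> a, [])) = (\<lambda>a. (up \<zeta> a, []))"
  by (rule ext) (simp add: cupr_def up_def split: nat.split)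

lemma ren_eq_psub:
  "ren M \<xi> \<zeta> = psub M (\<lambda>i. Var (\<xi> i)) (\<lambda>a. (\<zeta> a, []))"
  "ren_elim e \<xi> \<zeta> = psub_elim e (\<lambda>i. Var (\<xi> i)) (\<lambda>a. (\<zeta> a, []))"
proof (induction M and e arbitrary: \<xi> \<zeta> and \<xi> \<zeta>)
qed (simp_all add: ups_Var cupr_names, simp_all add: cups_def upr_def)

lemma up_ident [simp]: "up (\<lambda>i. i) = (\<lambda>i. i)"
  using up_id by (simp add: id_def)

lemma ren_id [simp]: "ren M id id = M" "ren_elim e id id = e"
  by (induction M and e) simp_all

lemma psub_id [simp]: "psub M Var idc = M" "psub_elim e Var idc = e"
  using ren_eq_psub[of _ id id] by simp_all

section \<open>Lifting and the two substitutions as instances of \<open>ren\<close> and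
  \<open>psub\<close>\<close>

abbreviation shift :: "nat \<Rightarrow> nat \<Rightarrow> nat" where
  "shift k \<equiv> \<lambda>i. if i < k then i else Suc i"

lemma up_shift: "up (shift k) = shift (Suc k)"
  by (rule ext) (simp add: up_def split: nat.split)

lemma shift_0: "shift 0 = Suc"
  by auto

lemma lift_eq_ren: "lift M k = ren M (shift k) id" "lift_elim e k = ren_elim e (shift k) id"
  by (induction M and e arbitrary: k and k) (simp_all add: up_shift)

lemma clift_eq_ren: "clift M k = ren M id (shift k)" "clift_elim e k = ren_elim e id (shift k)"
  by (induction M and e arbitrary: k and k) (simp_all add: up_shift)

lemma lift_0: "lift M 0 = ren M Suc id" "lift_elim e 0 = ren_elim e Suc id"
  by (simp_all add: lift_eq_ren shift_0)

lemma clift_0: "clift M 0 = ren M id Suc" "clift_elim e 0 = ren_elim e id Suc"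
  by (simp_all add: clift_eq_ren shift_0)

definition isubst_at :: "trm \<Rightarrow> nat \<Rightarrow> isub" where
  "isubst_at P k = (\<lambda>i. if i < k then Var i else if i = k then P else Var (i - 1))"

definition csubst_at :: "elim list \<Rightarrow> nat \<Rightarrow> csub" where
  "csubst_at \<pi> k = (\<lambda>a. (a, if a = k then \<pi> else []))"

lemma csubst_at_simps: "csubst_at \<pi> 0 0 = (0, \<pi>)" "csubst_at \<pi> 0 (Suc a) = (Suc a, [])"
  by (simp_all add: csubst_at_def)

text \<open>With \<open>csubst_eq_psub\<close> this moves all later reasoning to
  \<open>psub\<close>. The cut-off \<open>k\<close> is arbitrary because binders of the substituted
  kind raise it.\<close>

lemma subst_eq_psub:
  "subst M P k = psub M (isubst_at P k) idc"
  "subst_elim e P k = psub_elim e (isubst_at P k) idc"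
proof (induction M and e arbitrary: P k and P k)
qed (simp_all add: lift_0 clift_0, auto intro!: arg_cong2[where f = "psub _"]
      simp: isubst_at_def ups_def cups_def upr_def cupr_def fun_eq_iff split: nat.splits)

lemma csubst_eq_psub:
  "csubst M \<epsilon> k = psub M Var (csubst_at [\<epsilon>] k)"
  "csubst_elim e \<epsilon> k = psub_elim e Var (csubst_at [\<epsilon>] k)"
proof (induction M and e arbitrary: \<epsilon> k and \<epsilon> k)
qed (simp_all add: lift_0 clift_0, auto intro!: arg_cong2[where f = "psub _"]
      simp: csubst_at_def ups_def cups_def upr_def cupr_def fun_eq_iff split: nat.splits)

section \<open>Substitution for index 0\<close>

definition icons :: "trm \<Rightarrow> isub \<Rightarrow> isub" where
  "icons P \<sigma> = case_nat P \<sigma>"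

definition ccons :: "nat \<times> elim list \<Rightarrow> csub \<Rightarrow> csub" where
  "ccons p \<rho> = case_nat p \<rho>"

lemma psub_ren_Suc:
  "psub (ren M Suc id) (icons P \<sigma>) \<rho> = psub M \<sigma> \<rho>"
  "psub_elim (ren_elim e Suc id) (icons P \<sigma>) \<rho> = psub_elim e \<sigma> \<rho>"
  by (simp_all add: psub_ren comp_def icons_def)

text \<open>The lifting done by \<open>ups\<close> and \<open>upr\<close> is cancelled when index 0
  is instantiated. In this form the induction hypothesis for the body of a binder speaks about its
  instances.\<close>

lemma subst_psub_ups: "subst (psub M (ups \<sigma>) (upr \<rho>)) P 0 = psub M (icons P \<sigma>) \<rho>"
proof -
  have 1: "isubst_at P 0 = icons P Var"
    by (rule ext) (simp add: isubst_at_def icons_def split: nat.split)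
  have "comp_isub (ups \<sigma>) (icons P Var) idc i = icons P \<sigma> i" for i
  proof (cases i)
    case (Suc j)
    then show ?thesis by (simp add: comp_isub_def ups_def psub_ren_Suc) (simp add: icons_def)
  qed (simp add: comp_isub_def ups_def icons_def)
  then have 2: "comp_isub (ups \<sigma>) (icons P Var) idc = icons P \<sigma>" ..
  have 3: "comp_csub (upr \<rho>) (icons P Var) idc = \<rho>"
    by (rule ext) (simp add: comp_csub_def upr_def psub_ren_Suc comp_def split: prod.split)
  show ?thesis by (simp add: subst_eq_psub 1 psub_psub 2 3)
qed

lemma psub_subst: "psub (subst M P 0) \<sigma> \<rho> = subst (psub M (ups \<sigma>) (upr \<rho>)) (psub P \<sigma> \<rho>) 0"
proof -
  have 1: "comp_isub (isubst_at P 0) \<sigma> \<rho> = icons (psub P \<sigma> \<rho>) \<sigma>"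
    by (rule ext) (simp add: comp_isub_def isubst_at_def icons_def split: nat.split)
  have 2: "comp_csub idc \<sigma> \<rho> = \<rho>"
    by (rule ext) (simp add: comp_csub_def split: prod.split)
  show ?thesis by (simp add: subst_psub_ups) (simp add: subst_eq_psub psub_psub 1 2)
qed

lemma subst_lift_elim [simp]: "subst_elim (ren_elim e Suc id) P 0 = e"
proof -
  have "isubst_at P 0 \<circ> Suc = Var" "idc \<circ> id = idc"
    by (auto simp: isubst_at_def)
  then show ?thesis by (simp only: subst_eq_psub psub_ren psub_id)
qed

text \<open>The iterated substitution for the name 0 along a whole stack. The stack lives outside
  the scope of that name and is lifted into it.\<close>

abbreviation csubst_stack :: "trm \<Rightarrow> elim list \<Rightarrow> trm" where
  "csubst_stack M \<pi> \<equiv> psub M Var (csubst_at (ren_stack \<pi> id Suc) 0)"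

lemma psub_csubst_at_fresh:
  "psub (ren M id Suc) Var (csubst_at \<pi> 0) = ren M id Suc"
  "psub_elim (ren_elim e id Suc) Var (csubst_at \<pi> 0) = ren_elim e id Suc"
proof -
  have "csubst_at \<pi> 0 \<circ> Suc = (\<lambda>a. (Suc a, []))"
    by (rule ext) (simp add: csubst_at_def)
  then show "psub (ren M id Suc) Var (csubst_at \<pi> 0) = ren M id Suc"
    "psub_elim (ren_elim e id Suc) Var (csubst_at \<pi> 0) = ren_elim e id Suc"
    by (simp_all only: psub_ren comp_id) (simp_all add: ren_eq_psub)
qed

lemma csubst_psub_cupr:
  "csubst_stack (psub M (cups \<sigma>) (cupr \<rho>)) \<pi> =
   psub M (cups \<sigma>) (ccons (0, ren_stack \<pi> id Suc) (\<lambda>a. cupr \<rho> (Suc a)))"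
proof -
  let ?\<kappa> = "ren_stack \<pi> id Suc"
  note l = psub_csubst_at_fresh
  have 1: "comp_isub (cups \<sigma>) Var (csubst_at ?\<kappa> 0) = cups \<sigma>"
    by (rule ext) (simp add: comp_isub_def cups_def l)
  have "comp_csub (cupr \<rho>) Var (csubst_at ?\<kappa> 0) a = ccons (0, ?\<kappa>) (\<lambda>a. cupr \<rho> (Suc a)) a" for a
    by (cases a) (simp_all add: comp_csub_def cupr_simps ccons_def l comp_def csubst_at_simps)
  then have 2: "comp_csub (cupr \<rho>) Var (csubst_at ?\<kappa> 0) = ccons (0, ?\<kappa>) (\<lambda>a. cupr \<rho> (Suc a))" ..
  show ?thesis by (simp add: psub_psub 1 2)
qed

lemma psub_csubst_stack:
  "psub (csubst_stack M \<pi>) (cups \<sigma>) (cupr \<rho>) = csubst_stack (psub M (cups \<sigma>) (cupr \<rho>)) (psub_stack \<pi> \<sigma> \<rho>)"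
proof -
  have l: "psub_elim (ren_elim e id Suc) (cups \<sigma>) (cupr \<rho>) = ren_elim (psub_elim e \<sigma> \<rho>) id Suc" for e
    by (simp add: psub_ren ren_psub cupr_Suc cups_id)
  have 1: "comp_isub Var (cups \<sigma>) (cupr \<rho>) = cups \<sigma>"
    by (rule ext) (simp add: comp_isub_def)
  have "comp_csub (csubst_at (ren_stack \<pi> id Suc) 0) (cups \<sigma>) (cupr \<rho>) a =
    ccons (0, ren_stack (psub_stack \<pi> \<sigma> \<rho>) id Suc) (\<lambda>a. cupr \<rho> (Suc a)) a" for a
    by (cases a) (simp_all add: comp_csub_def cupr_simps ccons_def l comp_def csubst_at_simps)
  then have 2: "comp_csub (csubst_at (ren_stack \<pi> id Suc) 0) (cups \<sigma>) (cupr \<rho>) =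
    ccons (0, ren_stack (psub_stack \<pi> \<sigma> \<rho>) id Suc) (\<lambda>a. cupr \<rho> (Suc a))" ..
  show ?thesis by (simp only: csubst_psub_cupr) (simp only: psub_psub 1 2)
qed

lemma csubst_eq_csubst_stack: "csubst M (clift_elim \<epsilon> 0) 0 = csubst_stack M [\<epsilon>]"
  by (simp add: csubst_eq_psub clift_0)

text \<open>The lifted \<open>\<pi>\<close> does not contain the name 0, so the second substitution
  only appends \<open>\<kappa>\<close> where \<open>\<pi>\<close> was inserted. Successive
  \<mu>-steps thus accumulate in one substitution.\<close>

lemma csubst_stack_append: "csubst_stack (csubst_stack M \<pi>) \<kappa> = csubst_stack M (\<pi> @ \<kappa>)"
proof -
  let ?\<kappa> = "ren_stack \<kappa> id Suc"
  note l = psub_csubst_at_fresh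
  have 1: "comp_isub Var Var (csubst_at ?\<kappa> 0) = Var"
    by (rule ext) (simp add: comp_isub_def)
  have "comp_csub (csubst_at (ren_stack \<pi> id Suc) 0) Var (csubst_at ?\<kappa> 0) a =
      csubst_at (ren_stack (\<pi> @ \<kappa>) id Suc) 0 a" for a
    by (cases a) (simp_all add: comp_csub_def l comp_def csubst_at_simps)
  then have 2: "comp_csub (csubst_at (ren_stack \<pi> id Suc) 0) Var (csubst_at ?\<kappa> 0) =
      csubst_at (ren_stack (\<pi> @ \<kappa>) id Suc) 0" ..
  show ?thesis by (simp add: psub_psub 1 2)
qed

lemma csubst_at_Nil [simp]: "csubst_at [] 0 = idc"
  by (rule ext) (simp add: csubst_at_def)

subsection \<open>Reduction of terms applied to a stack\<close>

lemma red_app_stack: "M \<triangleright> M' \<Longrightarrow> M \<star> \<pi> \<triangleright> M' \<star> \<pi>"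
  by (induction \<pi> arbitrary: M M') (simp_all add: App_fun)

lemma psub_lift: "psub (ren M Suc id) (ups \<sigma>) (upr \<rho>) = ren (psub M \<sigma> \<rho>) Suc id"
  "psub_elim (ren_elim e Suc id) (ups \<sigma>) (upr \<rho>) = ren_elim (psub_elim e \<sigma> \<rho>) Suc id"
  by (simp_all add: psub_ren ren_psub ups_Suc upr_id)

text \<open>Below a name, the redex may end up under an inserted stack, which
  \<open>red_app_stack\<close> allows. The rules \<open>perm\<close> and \<open>mu\<close> move
  \<open>\<epsilon>\<close> under a binder, where substitution commutes with lifting.\<close>

lemma psub_red:
  "M \<triangleright> M' \<Longrightarrow> psub M \<sigma> \<rho> \<triangleright> psub M' \<sigma> \<rho>"
  "e \<triangleright>\<^sub>e e' \<Longrightarrow> psub_elim e \<sigma> \<rho> \<triangleright>\<^sub>e psub_elim e' \<sigma> \<rho>"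
proof (induction arbitrary: \<sigma> \<rho> and \<sigma> \<rho> rule: red_red_elim.inducts)
  case (perm M N1 N2 \<epsilon>)
  then show ?case
    using red_red_elim.perm[of _ _ _ "psub_elim \<epsilon> \<sigma> \<rho>"] by (simp add: lift_0 psub_lift)
next
  case (mu M \<epsilon>)
  then show ?case
    using red_red_elim.mu[of "psub M (cups \<sigma>) (cupr \<rho>)" "psub_elim \<epsilon> \<sigma> \<rho>"]
      psub_csubst_stack[of M "[\<epsilon>]" \<sigma> \<rho>]
    by (simp add: csubst_eq_csubst_stack)
qed (auto intro: red_red_elim.intros red_app_stack simp: psub_subst)

lemma ren_red:
  "M \<triangleright> M' \<Longrightarrow> ren M \<xi> \<zeta> \<triangleright> ren M' \<xi> \<zeta>"
  "e \<triangleright>\<^sub>e e' \<Longrightarrow> ren_elim e \<xi> \<zeta> \<triangleright>\<^sub>e ren_elim e' \<xi> \<zeta>"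
  by (simp_all add: ren_eq_psub psub_red)

lemma subst_red: "M \<triangleright> M' \<Longrightarrow> subst M P k \<triangleright> subst M' P k"
  by (simp add: subst_eq_psub psub_red)

section \<open>Reduction of stacks and the three kinds of steps of
  \<open>M \<star> \<pi>\<close>\<close>

inductive stack_red :: "elim list \<Rightarrow> elim list \<Rightarrow> bool" (infix "\<triangleright>\<^sub>s" 50) where
  stack_head: "e \<triangleright>\<^sub>e e' \<Longrightarrow> e # \<pi> \<triangleright>\<^sub>s e' # \<pi>"
| stack_tail: "\<pi> \<triangleright>\<^sub>s \<pi>' \<Longrightarrow> e # \<pi> \<triangleright>\<^sub>s e # \<pi>'"
| stack_perm: "Case N1 N2 # e # \<pi> \<triangleright>\<^sub>s
    Case (App N1 (lift_elim e 0)) (App N2 (lift_elim e 0)) # \<pi>"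

text \<open>The contractions of a head with its first eliminator. The permutative clause needs an
  application as head, so it cannot arise for introductions, variables or
  \<mu>-abstractions.\<close>

inductive top_red :: "trm \<Rightarrow> elim \<Rightarrow> trm \<Rightarrow> bool" where
  "top_red (Lam M) (Arg N) (subst M N 0)"
| "top_red (Pair M1 M2) Pi1 M1"
| "top_red (Pair M1 M2) Pi2 M2"
| "top_red (Inj1 M) (Case N1 N2) (subst N1 M 0)"
| "top_red (Inj2 M) (Case N1 N2) (subst N2 M 0)"
| "top_red (App M (Case N1 N2)) e (App M (Case (App N1 (lift_elim e 0)) (App N2 (lift_elim e 0))))"
| "top_red (Mu M) e (Mu (csubst M (clift_elim e 0) 0))"

inductive_cases App_redE: "App M e \<triangleright> T"

lemma App_red_cases:
  assumes "App M e \<triangleright> T"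
  obtains M' where "M \<triangleright> M'" "T = App M' e"
  | e' where "e \<triangleright>\<^sub>e e'" "T = App M e'"
  | "top_red M e T"
  using assms by (elim App_redE) (auto intro: top_red.intros)

lemma app_stack_red_cases:
  assumes "M \<star> \<pi> \<triangleright> T"
  obtains M' where "M \<triangleright> M'" "T = M' \<star> \<pi>"
  | \<pi>' where "\<pi> \<triangleright>\<^sub>s \<pi>'" "T = M \<star> \<pi>'"
  | e \<kappa> T' where "\<pi> = e # \<kappa>" "top_red M e T'" "T = T' \<star> \<kappa>"
proof -
  have "(\<exists>M'. M \<triangleright> M' \<and> T = M' \<star> \<pi>) \<or> (\<exists>\<pi>'. \<pi> \<triangleright>\<^sub>s \<pi>' \<and> T = M \<star> \<pi>') \<or>
      (\<exists>e \<kappa> T'. \<pi> = e # \<kappa> \<and> top_red M e T' \<and> T = T' \<star> \<kappa>)"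
    using assms
  proof (induction \<pi> arbitrary: M)
    case (Cons e \<pi>)
    then have "App M e \<star> \<pi> \<triangleright> T" by simp
    from Cons.IH[OF this] consider
      M' where "App M e \<triangleright> M'" "T = M' \<star> \<pi>"
      | \<pi>' where "\<pi> \<triangleright>\<^sub>s \<pi>'" "T = App M e \<star> \<pi>'"
      | e' \<kappa> T' where "\<pi> = e' # \<kappa>" "top_red (App M e) e' T'" "T = T' \<star> \<kappa>"
      by blast
    then show ?case
    proof cases
      case 1
      from 1(1) show ?thesis
      proof (cases rule: App_red_cases)
        case (2 e')
        then have "e # \<pi> \<triangleright>\<^sub>s e' # \<pi>" "T = M \<star> (e' # \<pi>)"
          using 1(2) by (simp_all add: stack_head)
        then show ?thesis by blast
      qed (use 1(2) in auto)
    next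
      case 2
      then have "e # \<pi> \<triangleright>\<^sub>s e # \<pi>'" "T = M \<star> (e # \<pi>')"
        by (simp_all add: stack_tail)
      then show ?thesis by blast
    next
      \<comment> \<open>The head \<open>App M e\<close> is an application, so the contraction is
        permutative. It becomes a step of the stack once \<open>e\<close> is returned to it.\<close>
      case 3
      from 3(2) obtain N1 N2 where e: "e = Case N1 N2"
        and T': "T' = App M (Case (App N1 (lift_elim e' 0)) (App N2 (lift_elim e' 0)))"
        by (cases rule: top_red.cases) auto
      then have "e # \<pi> \<triangleright>\<^sub>s Case (App N1 (lift_elim e' 0)) (App N2 (lift_elim e' 0)) # \<kappa>"
        using 3(1) by (simp add: stack_perm)
      moreover have "T = M \<star> (Case (App N1 (lift_elim e' 0)) (App N2 (lift_elim e' 0)) # \<kappa>)"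
        using 3(3) T' by simp
      ultimately show ?thesis by blast
    qed
  qed simp
  with that show ?thesis by blast
qed

lemma red_stack: "\<pi> \<triangleright>\<^sub>s \<pi>' \<Longrightarrow> M \<star> \<pi> \<triangleright> M \<star> \<pi>'"
proof (induction arbitrary: M rule: stack_red.induct)
qed (auto intro: red_app_stack App_elim perm)

lemma ren_stack_red: "\<pi> \<triangleright>\<^sub>s \<pi>' \<Longrightarrow> ren_stack \<pi> \<xi> \<zeta> \<triangleright>\<^sub>s ren_stack \<pi>' \<xi> \<zeta>"
proof (induction rule: stack_red.induct)
  case (stack_perm N1 N2 e \<pi>)
  have "ren_elim (lift_elim e 0) (up \<xi>) \<zeta> = lift_elim (ren_elim e \<xi> \<zeta>) 0"
    by (simp add: lift_0 ren_ren up_Suc)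
  then show ?case by (simp add: stack_red.stack_perm)
qed (auto intro: stack_red.intros ren_red)

text \<open>A permutation merges two eliminators and all other steps keep the length, so a bound on
  the length in \<open>sn_mu\<close> survives reduction of the stack.\<close>

lemma stack_red_length: "\<pi> \<triangleright>\<^sub>s \<pi>' \<Longrightarrow> length \<pi>' \<le> length \<pi>"
  by (induction rule: stack_red.induct) auto

section \<open>Reduction inside the substituted terms and stacks\<close>

abbreviation reds :: "trm \<Rightarrow> trm \<Rightarrow> bool" (infix "\<triangleright>\<^sup>*" 50) where
  "M \<triangleright>\<^sup>* M' \<equiv> (\<triangleright>)\<^sup>*\<^sup>* M M'"

lemma reds_map:
  assumes "M \<triangleright>\<^sup>* M'" "\<And>M M'. M \<triangleright> M' \<Longrightarrow> R\<^sup>*\<^sup>* (f M) (f M')"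
  shows "R\<^sup>*\<^sup>* (f M) (f M')"
  using assms(1) by (induction) (auto intro: rtranclp_trans assms(2))

definition reds_isub :: "isub \<Rightarrow> isub \<Rightarrow> bool" where
  "reds_isub \<sigma> \<sigma>' \<longleftrightarrow> (\<forall>i. \<sigma> i \<triangleright>\<^sup>* \<sigma>' i)"

definition reds_csub :: "csub \<Rightarrow> csub \<Rightarrow> bool" where
  "reds_csub \<rho> \<rho>' \<longleftrightarrow> (\<forall>a. fst (\<rho> a) = fst (\<rho>' a) \<and> (\<triangleright>\<^sub>s)\<^sup>*\<^sup>* (snd (\<rho> a)) (snd (\<rho>' a)))"

lemma reds_ren: "M \<triangleright>\<^sup>* M' \<Longrightarrow> ren M \<xi> \<zeta> \<triangleright>\<^sup>* ren M' \<xi> \<zeta>"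
  by (erule reds_map) (auto intro: ren_red)

lemma reds_ren_stack: "(\<triangleright>\<^sub>s)\<^sup>*\<^sup>* \<pi> \<pi>' \<Longrightarrow> (\<triangleright>\<^sub>s)\<^sup>*\<^sup>* (ren_stack \<pi> \<xi> \<zeta>) (ren_stack \<pi>' \<xi> \<zeta>)"
  by (induction rule: rtranclp_induct) (auto intro: ren_stack_red rtranclp.rtrancl_into_rtrancl)

lemma reds_sub_lift:
  "reds_isub \<sigma> \<sigma>' \<Longrightarrow> reds_isub (ups \<sigma>) (ups \<sigma>')"
  "reds_isub \<sigma> \<sigma>' \<Longrightarrow> reds_isub (cups \<sigma>) (cups \<sigma>')"
  "reds_csub \<rho> \<rho>' \<Longrightarrow> reds_csub (upr \<rho>) (upr \<rho>')"
  "reds_csub \<rho> \<rho>' \<Longrightarrow> reds_csub (cupr \<rho>) (cupr \<rho>')"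
  by (auto simp: reds_isub_def reds_csub_def ups_def cups_def upr_def cupr_def
      intro: reds_ren reds_ren_stack split: nat.split)

lemma reds_app_stack:
  assumes "M \<triangleright>\<^sup>* M'" "(\<triangleright>\<^sub>s)\<^sup>*\<^sup>* \<pi> \<pi>'"
  shows "M \<star> \<pi> \<triangleright>\<^sup>* M' \<star> \<pi>'"
proof -
  have "M \<star> \<pi> \<triangleright>\<^sup>* M' \<star> \<pi>"
    by (rule reds_map[OF assms(1)]) (auto intro: red_app_stack)
  moreover have "M' \<star> \<pi> \<triangleright>\<^sup>* M' \<star> \<pi>'"
    using assms(2) by (induction) (auto intro: red_stack rtranclp.rtrancl_into_rtrancl)
  ultimately show ?thesis by (rule rtranclp_trans)
qed

lemma reds_cong:
  "M \<triangleright>\<^sup>* M' \<Longrightarrow> Lam M \<triangleright>\<^sup>* Lam M'"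
  "M \<triangleright>\<^sup>* M' \<Longrightarrow> Inj1 M \<triangleright>\<^sup>* Inj1 M'"
  "M \<triangleright>\<^sup>* M' \<Longrightarrow> Inj2 M \<triangleright>\<^sup>* Inj2 M'"
  "M \<triangleright>\<^sup>* M' \<Longrightarrow> Mu M \<triangleright>\<^sup>* Mu M'"
  "M \<triangleright>\<^sup>* M' \<Longrightarrow> Named a M \<triangleright>\<^sup>* Named a M'"
  "M \<triangleright>\<^sup>* M' \<Longrightarrow> (\<triangleright>\<^sub>e)\<^sup>*\<^sup>* (Arg M) (Arg M')"
  by (erule reds_map, auto intro: red_red_elim.intros)+

lemma reds_cong2:
  "M \<triangleright>\<^sup>* M' \<Longrightarrow> N \<triangleright>\<^sup>* N' \<Longrightarrow> Pair M N \<triangleright>\<^sup>* Pair M' N'"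
  "M \<triangleright>\<^sup>* M' \<Longrightarrow> N \<triangleright>\<^sup>* N' \<Longrightarrow> (\<triangleright>\<^sub>e)\<^sup>*\<^sup>* (Case M N) (Case M' N')"
proof -
  assume M: "M \<triangleright>\<^sup>* M'" and N: "N \<triangleright>\<^sup>* N'"
  have "Pair M N \<triangleright>\<^sup>* Pair M' N"
    by (rule reds_map[OF M]) (auto intro: red_red_elim.intros)
  also have "Pair M' N \<triangleright>\<^sup>* Pair M' N'"
    by (rule reds_map[OF N]) (auto intro: red_red_elim.intros)
  finally show "Pair M N \<triangleright>\<^sup>* Pair M' N'" .
  have "(\<triangleright>\<^sub>e)\<^sup>*\<^sup>* (Case M N) (Case M' N)"
    by (rule reds_map[OF M]) (auto intro: red_red_elim.intros)
  also have "(\<triangleright>\<^sub>e)\<^sup>*\<^sup>* (Case M' N) (Case M' N')"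
    by (rule reds_map[OF N]) (auto intro: red_red_elim.intros)
  finally show "(\<triangleright>\<^sub>e)\<^sup>*\<^sup>* (Case M N) (Case M' N')" .
qed

lemma reds_App:
  assumes "M \<triangleright>\<^sup>* M'" "(\<triangleright>\<^sub>e)\<^sup>*\<^sup>* e e'"
  shows "App M e \<triangleright>\<^sup>* App M' e'"
proof -
  have "App M e \<triangleright>\<^sup>* App M' e"
    by (rule reds_map[OF assms(1)]) (auto intro: red_red_elim.intros)
  also have "App M' e \<triangleright>\<^sup>* App M' e'"
    using assms(2) by (induction) (auto intro: App_elim rtranclp.rtrancl_into_rtrancl)
  finally show ?thesis .
qed

text \<open>A substituted term or stack may be copied or erased, so one step inside it corresponds
  to any number of steps of the result.\<close>

lemma reds_psub:
  "reds_isub \<sigma> \<sigma>' \<Longrightarrow> reds_csub \<rho> \<rho>' \<Longrightarrow> psub M \<sigma> \<rho> \<triangleright>\<^sup>* psub M \<sigma>' \<rho>'"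
  "reds_isub \<sigma> \<sigma>' \<Longrightarrow> reds_csub \<rho> \<rho>' \<Longrightarrow> (\<triangleright>\<^sub>e)\<^sup>*\<^sup>* (psub_elim e \<sigma> \<rho>) (psub_elim e \<sigma>' \<rho>')"
proof (induction M and e arbitrary: \<sigma> \<sigma>' \<rho> \<rho>' and \<sigma> \<sigma>' \<rho> \<rho>')
  case (Var i)
  then show ?case by (simp add: reds_isub_def)
next
  case (Named a M)
  then have "psub M \<sigma> \<rho> \<star> snd (\<rho> a) \<triangleright>\<^sup>* psub M \<sigma>' \<rho>' \<star> snd (\<rho>' a)"
    by (intro reds_app_stack) (auto simp: reds_csub_def)
  then show ?case
    using Named.prems by (simp add: reds_csub_def reds_cong)
qed (simp_all add: reds_cong reds_cong2 reds_App reds_sub_lift)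

lemma subst_reds: "P \<triangleright> P' \<Longrightarrow> subst M P 0 \<triangleright>\<^sup>* subst M P' 0"
  by (auto simp: subst_eq_psub isubst_at_def reds_isub_def reds_csub_def intro!: reds_psub)

lemma csubst_stack_reds: "\<pi> \<triangleright>\<^sub>s \<pi>' \<Longrightarrow> csubst_stack M \<pi> \<triangleright>\<^sup>* csubst_stack M \<pi>'"
  by (auto simp: csubst_at_def reds_isub_def reds_csub_def intro!: reds_psub ren_stack_red)

subsection \<open>Strong normalization of terms applied to a stack\<close>

text \<open>An infinite sequence from \<open>x\<close> would be mapped by \<open>f\<close> to one
  from \<open>f x\<close>. Injectivity of \<open>f\<close> does not enter, so instances include
  substitutions and renamings that identify variables.\<close>

lemma accp_reflect:
  assumes "Wellfounded.accp r (f x)" "\<And>x y. s y x \<Longrightarrow> r (f y) (f x)"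
  shows "Wellfounded.accp s x"
  using assms(1)
proof (induction "f x" arbitrary: x rule: accp_induct_rule)
  case 1
  show ?case
    by (rule accp.intros) (use 1(2) assms(2) in blast)
qed

text \<open>Lexicographic induction: when the first component decreases, the second may be replaced
  by any accessible element.\<close>

lemma accp_induct2 [consumes 2]:
  assumes "Wellfounded.accp r x" "Wellfounded.accp s y"
    and step: "\<And>x y. \<lbrakk>Wellfounded.accp r x; Wellfounded.accp s y;
      \<And>x' y'. r x' x \<Longrightarrow> Wellfounded.accp s y' \<Longrightarrow> P x' y'; \<And>y'. s y' y \<Longrightarrow> P x y'\<rbrakk> \<Longrightarrow> P x y"
  shows "P x y"
  using assms(1,2)
proof (induction x arbitrary: y rule: accp_induct_rule)
  case (1 x)
  note x = 1
  from x(3) show ?case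
  proof (induction y rule: accp_induct_rule)
    case (1 y)
    show ?case
      by (rule step) (use x(1,2) 1 in blast)+
  qed
qed

abbreviation sn :: "trm \<Rightarrow> bool" where
  "sn \<equiv> Wellfounded.accp (\<lambda>N M. M \<triangleright> N)"

abbreviation sn_stack :: "elim list \<Rightarrow> bool" where
  "sn_stack \<equiv> Wellfounded.accp (\<lambda>\<kappa> \<pi>. \<pi> \<triangleright>\<^sub>s \<kappa>)"

lemma sn_red: "sn M \<Longrightarrow> M \<triangleright> M' \<Longrightarrow> sn M'"
  by (erule accp_downward)

lemma sn_reds: "M \<triangleright>\<^sup>* M' \<Longrightarrow> sn M \<Longrightarrow> sn M'"
  by (induction rule: rtranclp_induct) (auto intro: sn_red)

lemma sn_stack_red: "sn_stack \<pi> \<Longrightarrow> \<pi> \<triangleright>\<^sub>s \<kappa> \<Longrightarrow> sn_stack \<kappa>"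
  by (erule accp_downward)

lemma sn_psubD: "sn (psub M \<sigma> \<rho>) \<Longrightarrow> sn M"
  by (erule accp_reflect) (rule psub_red)

lemma sn_renD: "sn (ren M \<xi> \<zeta>) \<Longrightarrow> sn M"
  by (erule accp_reflect) (rule ren_red)

lemma sn_substD: "sn (subst M P k) \<Longrightarrow> sn M"
  by (erule accp_reflect) (rule subst_red)

lemma sn_app_stackD: "sn (M \<star> \<pi>) \<Longrightarrow> sn M" "sn (M \<star> \<pi>) \<Longrightarrow> sn_stack \<pi>"
  by (erule accp_reflect, rule red_app_stack, assumption)
    (erule accp_reflect, rule red_stack, assumption)

lemma sn_stack_tl: "sn_stack (e # \<pi>) \<Longrightarrow> sn_stack \<pi>"
  by (erule accp_reflect) (rule stack_tail)

inductive_cases stack_red_ConsE [consumes 1, case_names head tail perm]: "e # \<pi> \<triangleright>\<^sub>s \<kappa>"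
inductive_cases Arg_redE: "Arg N \<triangleright>\<^sub>e e"
inductive_cases Pi1_redE: "Pi1 \<triangleright>\<^sub>e e"
inductive_cases Pi2_redE: "Pi2 \<triangleright>\<^sub>e e"
inductive_cases Case_redE [consumes 1, case_names left right]: "Case N1 N2 \<triangleright>\<^sub>e e"
inductive_cases Var_redE: "Var i \<triangleright> M"
inductive_cases Lam_redE: "Lam N \<triangleright> M"
inductive_cases Pair_redE: "Pair N1 N2 \<triangleright> M"
inductive_cases Inj1_redE: "Inj1 N \<triangleright> M"
inductive_cases Inj2_redE: "Inj2 N \<triangleright> M"
inductive_cases Mu_redE: "Mu N \<triangleright> M"
inductive_cases Named_redE: "Named a N \<triangleright> M"

section \<open>Closure of strong normalization under constructors and stack formation\<close>

lemma sn_Named: "sn M \<Longrightarrow> sn (Named a M)"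
proof (induction rule: accp_induct_rule)
  case (1 M)
  show ?case by (rule accp.intros) (use 1(2) in \<open>auto elim: Named_redE\<close>)
qed

lemma sn_Inj1: "sn M \<Longrightarrow> sn (Inj1 M)"
proof (induction rule: accp_induct_rule)
  case (1 M)
  show ?case by (rule accp.intros) (use 1(2) in \<open>auto elim: Inj1_redE\<close>)
qed

lemma sn_Inj2: "sn M \<Longrightarrow> sn (Inj2 M)"
proof (induction rule: accp_induct_rule)
  case (1 M)
  show ?case by (rule accp.intros) (use 1(2) in \<open>auto elim: Inj2_redE\<close>)
qed

lemma sn_Pair: "sn M \<Longrightarrow> sn N \<Longrightarrow> sn (Pair M N)"
proof (induction rule: accp_induct2)
  case (1 M N)
  show ?case by (rule accp.intros) (use 1(2-4) in \<open>auto elim: Pair_redE\<close>)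
qed

lemma sn_Lam: "sn M \<Longrightarrow> sn (Lam M)"
proof (induction rule: accp_induct_rule)
  case (1 M)
  show ?case by (rule accp.intros) (use 1(2) in \<open>auto elim: Lam_redE\<close>)
qed

text \<open>A variable forms no redex with the first eliminator, so every step takes place in the
  stack.\<close>

lemma sn_Var_app_stack: "sn_stack \<pi> \<Longrightarrow> sn (Var i \<star> \<pi>)"
proof (induction rule: accp_induct_rule)
  case (1 \<pi>)
  show ?case
  proof (rule accp.intros)
    fix T assume "Var i \<star> \<pi> \<triangleright> T"
    then show "sn T"
    proof (cases rule: app_stack_red_cases)
      case (1 M') then show ?thesis by (auto elim: Var_redE)
    next
      case (2 \<pi>') then show ?thesis using 1(2) by auto
    next
      case (3 e \<kappa> T') then show ?thesis by (auto elim: top_red.cases)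
    qed
  qed
qed

lemma sn_stack_Nil: "sn_stack []"
  by (rule accp.intros) (auto elim: stack_red.cases)

lemma sn_stack_Arg: "sn N \<Longrightarrow> sn_stack \<pi> \<Longrightarrow> sn_stack (Arg N # \<pi>)"
proof (induction rule: accp_induct2)
  case (1 N \<pi>)
  show ?case by (rule accp.intros) (use 1(2-4) in \<open>auto elim!: stack_red_ConsE Arg_redE\<close>)
qed

lemma sn_stack_Pi:
  assumes "sn_stack \<pi>"
  shows "sn_stack (Pi1 # \<pi>)" "sn_stack (Pi2 # \<pi>)"
proof -
  show "sn_stack (Pi1 # \<pi>)" using assms
  proof (induction rule: accp_induct_rule)
    case (1 \<pi>)
    show ?case by (rule accp.intros) (use 1(2) in \<open>auto elim!: stack_red_ConsE Pi1_redE\<close>)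
  qed
  show "sn_stack (Pi2 # \<pi>)" using assms
  proof (induction rule: accp_induct_rule)
    case (1 \<pi>)
    show ?case by (rule accp.intros) (use 1(2) in \<open>auto elim!: stack_red_ConsE Pi2_redE\<close>)
  qed
qed

text \<open>This relates an instance of a branch applied to a stack, as in the stacks of a
  disjunction, to the open branch under the lifted stack, as in
  \<open>sn_stack_Case\<close>.\<close>

lemma subst_app_stack_lift: "subst (M \<star> ren_stack \<pi> Suc id) P 0 = subst M P 0 \<star> \<pi>"
proof -
  have "subst (M \<star> \<pi>) P k = subst M P k \<star> map (\<lambda>e. subst_elim e P k) \<pi>" for \<pi> k
    by (induction \<pi> arbitrary: M) simp_all
  then show ?thesis by (simp add: comp_def)
qed

text \<open>
  Permutations leave the two branches applied to the lifted stack unchanged and shorten the stack;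
  every other reduction of the stack reduces one of these two terms.
\<close>

lemma sn_stack_Case:
  assumes "sn (N1 \<star> ren_stack \<pi> Suc id)" "sn (N2 \<star> ren_stack \<pi> Suc id)"
  shows "sn_stack (Case N1 N2 # \<pi>)"
proof -
  \<comment> \<open>The applied branches get names \<open>U1\<close> and \<open>U2\<close>, so that
    the induction runs over them while their decomposition into branch and stack varies.\<close>
  have "sn_stack (Case N1 N2 # \<pi>)"
    if "sn U1" "sn U2" "U1 = N1 \<star> ren_stack \<pi> Suc id" "U2 = N2 \<star> ren_stack \<pi> Suc id" for U1 U2
    using that
  proof (induction arbitrary: N1 N2 \<pi> rule: accp_induct2)
    case (1 U1 U2)
    have IH1: "sn_stack (Case N1' N2' # \<pi>')"
      if "U1 \<triangleright> N1' \<star> ren_stack \<pi>' Suc id" "sn (N2' \<star> ren_stack \<pi>' Suc id)" for N1' N2' \<pi>'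
      using 1(3)[OF that refl refl] .
    have IH2: "sn_stack (Case N1' N2' # \<pi>')"
      if "U1 = N1' \<star> ren_stack \<pi>' Suc id" "U2 \<triangleright> N2' \<star> ren_stack \<pi>' Suc id" for N1' N2' \<pi>'
      using 1(4)[OF that(2,1) refl] .
    from 1(5,6) show ?case
    proof (induction \<pi> arbitrary: N1 N2)
      case Nil
      show ?case
      proof (rule accp.intros)
        fix \<kappa> assume "[Case N1 N2] \<triangleright>\<^sub>s \<kappa>"
        then show "sn_stack \<kappa>"
          by (rule stack_red_ConsE)
            (use Nil IH1[of _ "[]"] IH2[of _ "[]"] 1(2) in
              \<open>auto elim!: Case_redE elim: stack_red.cases\<close>)
      qed
    next
      case (Cons e \<pi>)
      show ?case
      proof (rule accp.intros)
        fix \<kappa> assume "Case N1 N2 # e # \<pi> \<triangleright>\<^sub>s \<kappa>"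
        then show "sn_stack \<kappa>"
        proof (cases rule: stack_red_ConsE)
          case (head e')
          from head(2) show ?thesis
          proof (cases rule: Case_redE)
            case (left N1')
            have "sn_stack (Case N1' N2 # e # \<pi>)"
              by (rule IH1, use Cons.prems \<open>sn U2\<close> left in \<open>simp_all only: red_app_stack\<close>)
            then show ?thesis using left head(1) by simp
          next
            case (right N2')
            have "sn_stack (Case N1 N2' # e # \<pi>)"
              by (rule IH2, use Cons.prems right in \<open>simp_all only: red_app_stack\<close>)
            then show ?thesis using right head(1) by simp
          qed
        next
          \<comment> \<open>Such a step reduces both applied branches at once. In the lexicographic
            order the decrease of the first suffices, the second only has to stay
            normalizable.\<close>
          case (tail \<pi>')
          then have r: "ren_stack (e # \<pi>) Suc id \<triangleright>\<^sub>s ren_stack \<pi>' Suc id" by (intro ren_stack_red)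
          have "sn_stack (Case N1 N2 # \<pi>')"
          proof (rule IH1)
            show "U1 \<triangleright> N1 \<star> ren_stack \<pi>' Suc id"
              unfolding Cons.prems(1) by (rule red_stack[OF r])
            show "sn (N2 \<star> ren_stack \<pi>' Suc id)"
              by (rule sn_red[OF \<open>sn U2\<close>]) (unfold Cons.prems(2), rule red_stack[OF r])
          qed
          then show ?thesis using tail by simp
        next
          case perm
          then have "\<kappa> = Case (App N1 (lift_elim e 0)) (App N2 (lift_elim e 0)) # \<pi>"
            by simp
          then show ?thesis using Cons.IH Cons.prems by (simp only: lift_0 list.map foldl_Cons)
        qed
      qed
    qed
  qed
  then show ?thesis using assms by blast
qed

text \<open>The common scheme of head expansion: \<open>Q\<close> is an invariant of head and stack,
  stable under steps on either side. Only the contraction of the head with the first eliminator is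
  left, and there \<open>Q\<close> has to supply normalizability.\<close>

lemma sn_head:
  assumes "sn H" "sn_stack \<pi>" "Q H \<pi>"
    and "\<And>H H' \<pi>. Q H \<pi> \<Longrightarrow> H \<triangleright> H' \<Longrightarrow> Q H' \<pi>"
    and "\<And>H \<pi> \<pi>'. Q H \<pi> \<Longrightarrow> \<pi> \<triangleright>\<^sub>s \<pi>' \<Longrightarrow> Q H \<pi>'"
    and top: "\<And>H e \<kappa> T. Q H (e # \<kappa>) \<Longrightarrow> top_red H e T \<Longrightarrow> sn (T \<star> \<kappa>)"
  shows "sn (H \<star> \<pi>)"
  using assms(1-3)
proof (induction rule: accp_induct2)
  case (1 H \<pi>)
  show ?case
  proof (rule accp.intros)
    fix T assume "H \<star> \<pi> \<triangleright> T"
    then show "sn T"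
      by (cases rule: app_stack_red_cases) (use 1(2-5) assms(4-6) in blast)+
  qed
qed

section \<open>Head expansion for the individual redexes\<close>

lemma sn_red_stack: "sn (M \<star> \<pi>) \<Longrightarrow> \<pi> \<triangleright>\<^sub>s \<pi>' \<Longrightarrow> sn (M \<star> \<pi>')"
  by (erule sn_red) (rule red_stack)

lemma sn_subst_red:
  "sn (subst M P 0 \<star> \<pi>) \<Longrightarrow> M \<triangleright> M' \<Longrightarrow> sn (subst M' P 0 \<star> \<pi>)"
  "sn (subst M P 0 \<star> \<pi>) \<Longrightarrow> P \<triangleright> P' \<Longrightarrow> sn (subst M P' 0 \<star> \<pi>)"
  by (erule sn_red, intro red_app_stack subst_red, assumption)
    (erule sn_reds[rotated], intro reds_app_stack subst_reds, simp_all)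

text \<open>Normalizability of \<open>M\<close> and \<open>\<pi>\<close> is read off the contractum,
  but that of \<open>N\<close> is required separately, since the contraction may erase it.\<close>

lemma sn_beta:
  assumes "sn (subst M N 0 \<star> \<pi>)" "sn N"
  shows "sn (Lam M \<star> (Arg N # \<pi>))"
proof (rule sn_head[where Q = "\<lambda>H s. \<exists>M N \<pi>. H = Lam M \<and> s = Arg N # \<pi> \<and> sn (subst M N 0 \<star> \<pi>)"])
  show "sn (Lam M)" "sn_stack (Arg N # \<pi>)"
    using assms by (auto dest: sn_app_stackD intro: sn_Lam sn_stack_Arg sn_substD)
  show "\<exists>M' N' \<pi>'. Lam M = Lam M' \<and> Arg N # \<pi> = Arg N' # \<pi>' \<and> sn (subst M' N' 0 \<star> \<pi>')"
    using assms(1) by blast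
next
  fix H H' s assume "\<exists>M N \<pi>. H = Lam M \<and> s = Arg N # \<pi> \<and> sn (subst M N 0 \<star> \<pi>)" "H \<triangleright> H'"
  then show "\<exists>M N \<pi>. H' = Lam M \<and> s = Arg N # \<pi> \<and> sn (subst M N 0 \<star> \<pi>)"
    by (auto elim!: Lam_redE intro: sn_subst_red)
next
  fix H s s' assume "\<exists>M N \<pi>. H = Lam M \<and> s = Arg N # \<pi> \<and> sn (subst M N 0 \<star> \<pi>)" "s \<triangleright>\<^sub>s s'"
  then show "\<exists>M N \<pi>. H = Lam M \<and> s' = Arg N # \<pi> \<and> sn (subst M N 0 \<star> \<pi>)"
    by (auto elim!: stack_red_ConsE Arg_redE intro: sn_red_stack sn_subst_red)
qed (auto elim: top_red.cases)

lemma sn_proj: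
  assumes "sn (M1 \<star> \<pi>)" "sn M2"
  shows "sn (Pair M1 M2 \<star> (Pi1 # \<pi>))" "sn (Pair M2 M1 \<star> (Pi2 # \<pi>))"
proof -
  show "sn (Pair M1 M2 \<star> (Pi1 # \<pi>))"
  proof (rule sn_head[where Q = "\<lambda>H s. \<exists>M N \<pi>. H = Pair M N \<and> s = Pi1 # \<pi> \<and> sn (M \<star> \<pi>)"])
    show "sn (Pair M1 M2)" "sn_stack (Pi1 # \<pi>)"
      using assms by (auto dest: sn_app_stackD intro: sn_Pair sn_stack_Pi)
  qed (auto elim: top_red.cases elim!: stack_red_ConsE Pair_redE Pi1_redE
      intro: sn_red sn_red_stack red_app_stack assms)
  show "sn (Pair M2 M1 \<star> (Pi2 # \<pi>))"
  proof (rule sn_head[where Q = "\<lambda>H s. \<exists>M N \<pi>. H = Pair N M \<and> s = Pi2 # \<pi> \<and> sn (M \<star> \<pi>)"])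
    show "sn (Pair M2 M1)" "sn_stack (Pi2 # \<pi>)"
      using assms by (auto dest: sn_app_stackD intro: sn_Pair sn_stack_Pi)
  qed (auto elim: top_red.cases elim!: stack_red_ConsE Pair_redE Pi2_redE
      intro: sn_red sn_red_stack red_app_stack assms)
qed

text \<open>The contractum says nothing about the discarded branch, hence the condition on the
  stack. A permutation preserves the invariant: instantiating a branch cancels the lifting of the
  absorbed eliminator, so the contractum with its stack is the same term as before.\<close>

lemma sn_case:
  assumes "sn (subst N M 0 \<star> \<pi>)" "sn M"
  shows "sn_stack (Case N N2 # \<pi>) \<Longrightarrow> sn (Inj1 M \<star> (Case N N2 # \<pi>))"
    and "sn_stack (Case N1 N # \<pi>) \<Longrightarrow> sn (Inj2 M \<star> (Case N1 N # \<pi>))"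
proof -
  assume s: "sn_stack (Case N N2 # \<pi>)"
  show "sn (Inj1 M \<star> (Case N N2 # \<pi>))"
  proof (rule sn_head[where Q = "\<lambda>H s. \<exists>M N1 N2 \<pi>.
      H = Inj1 M \<and> s = Case N1 N2 # \<pi> \<and> sn (subst N1 M 0 \<star> \<pi>)"])
  qed (auto elim: top_red.cases elim!: stack_red_ConsE Inj1_redE Case_redE
      intro: sn_red_stack sn_subst_red assms s sn_Inj1
      simp: lift_0)
next
  assume s: "sn_stack (Case N1 N # \<pi>)"
  show "sn (Inj2 M \<star> (Case N1 N # \<pi>))"
  proof (rule sn_head[where Q = "\<lambda>H s. \<exists>M N1 N2 \<pi>.
      H = Inj2 M \<and> s = Case N1 N2 # \<pi> \<and> sn (subst N2 M 0 \<star> \<pi>)"])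
  qed (auto elim: top_red.cases elim!: stack_red_ConsE Inj2_redE Case_redE
      intro: sn_red_stack sn_subst_red assms s sn_Inj2
      simp: lift_0)
qed

lemma sn_Mu: "sn M \<Longrightarrow> sn (Mu M)"
proof (induction rule: accp_induct_rule)
  case (1 M)
  show ?case by (rule accp.intros) (use 1(2) in \<open>auto elim: Mu_redE\<close>)
qed

text \<open>Contraction moves the first eliminator into the body and leaves a shorter stack, and by
  \<open>csubst_stack_append\<close> the total substitution is unchanged. The induction is on a
  bound of the length, since permutations shorten the stack too.\<close>

lemma sn_mu:
  assumes "sn (csubst_stack M \<pi>)" "sn_stack \<pi>"
  shows "sn (Mu M \<star> \<pi>)"
proof -
  have "sn (Mu M \<star> \<pi>)" if "length \<pi> \<le> n" "sn (csubst_stack M \<pi>)" "sn_stack \<pi>" for n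
    using that
  proof (induction n arbitrary: M \<pi>)
    \<comment> \<open>Here \<open>\<pi>\<close> is empty, and substituting the empty stack gives
      back \<open>M\<close>.\<close>
    case 0
    then show ?case by (simp add: sn_Mu)
  next
    case (Suc n)
    show ?case
    proof (rule sn_head[where Q = "\<lambda>H s. \<exists>M.
        H = Mu M \<and> length s \<le> Suc n \<and> sn (csubst_stack M s) \<and> sn_stack s"])
      show "sn (Mu M)" using Suc.prems(2) by (intro sn_Mu) (rule sn_psubD)
      show "sn_stack \<pi>" "\<exists>M'. Mu M = Mu M' \<and> length \<pi> \<le> Suc n \<and> sn (csubst_stack M' \<pi>) \<and> sn_stack \<pi>"
        using Suc.prems by blast+
    next
      fix H H' s assume "\<exists>M. H = Mu M \<and> length s \<le> Suc n \<and> sn (csubst_stack M s) \<and> sn_stack s" "H \<triangleright> H'"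
      then show "\<exists>M. H' = Mu M \<and> length s \<le> Suc n \<and> sn (csubst_stack M s) \<and> sn_stack s"
        by (auto elim!: Mu_redE intro: sn_red psub_red)
    next
      fix H s s' assume "\<exists>M. H = Mu M \<and> length s \<le> Suc n \<and> sn (csubst_stack M s) \<and> sn_stack s" "s \<triangleright>\<^sub>s s'"
      then show "\<exists>M. H = Mu M \<and> length s' \<le> Suc n \<and> sn (csubst_stack M s') \<and> sn_stack s'"
        using sn_reds[OF csubst_stack_reds] sn_stack_red stack_red_length le_trans by (elim exE conjE) metis
    next
      fix H e \<kappa> T
      assume "\<exists>M. H = Mu M \<and> length (e # \<kappa>) \<le> Suc n \<and> sn (csubst_stack M (e # \<kappa>)) \<and> sn_stack (e # \<kappa>)"
        and "top_red H e T"
      then obtain M where M: "top_red (Mu M) e T" "length \<kappa> \<le> n"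
        "sn (csubst_stack M (e # \<kappa>))" "sn_stack \<kappa>"
        using sn_stack_tl by (elim exE conjE) (metis Suc_le_mono length_Cons)
      moreover have "T = Mu (csubst_stack M [e])"
        using M(1) by (cases rule: top_red.cases) (simp only: csubst_eq_csubst_stack)
      ultimately show "sn (T \<star> \<kappa>)"
        using Suc.IH[of \<kappa> "csubst_stack M [e]"] by (simp only: csubst_stack_append append.simps)
    qed
  qed
  then show ?thesis using assms by blast
qed

subsection \<open>Candidates\<close>

text \<open>The conditions on \<open>N\<close> and \<open>P\<close> are membership in candidates,
  spelled out because \<open>cand\<close> is defined from \<open>stacks\<close>. The empty stack is
  always present, so candidates contain only normalizable terms. For a disjunction the tail is not
  tied to any formula, as the type of the branches is unrelated to \<open>A\<close> and
  \<open>B\<close>.\<close>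

primrec stacks :: "'p form \<Rightarrow> elim list set" where
  "stacks (Atom p) = {[]}"
| "stacks Bot = {[]}"
| "stacks (Imp A B) = insert []
     {Arg N # \<pi> | N \<pi>. (\<forall>\<kappa> \<in> stacks A. sn (N \<star> \<kappa>)) \<and> \<pi> \<in> stacks B}"
| "stacks (Conj A B) = insert [] ((#) Pi1 ` stacks A \<union> (#) Pi2 ` stacks B)"
| "stacks (Disj A B) = insert []
     {Case N1 N2 # \<pi> | N1 N2 \<pi>.
       (\<forall>P. (\<forall>\<kappa> \<in> stacks A. sn (P \<star> \<kappa>)) \<longrightarrow> sn (subst N1 P 0 \<star> \<pi>)) \<and>
       (\<forall>P. (\<forall>\<kappa> \<in> stacks B. sn (P \<star> \<kappa>)) \<longrightarrow> sn (subst N2 P 0 \<star> \<pi>))}"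

definition cand :: "'p form \<Rightarrow> trm set" where
  "cand A = {M. \<forall>\<pi> \<in> stacks A. sn (M \<star> \<pi>)}"

lemma candI: "(\<And>\<pi>. \<pi> \<in> stacks A \<Longrightarrow> sn (M \<star> \<pi>)) \<Longrightarrow> M \<in> cand A"
  by (simp add: cand_def)

lemma candD: "M \<in> cand A \<Longrightarrow> \<pi> \<in> stacks A \<Longrightarrow> sn (M \<star> \<pi>)"
  by (simp add: cand_def)

lemma Nil_in_stacks [simp]: "[] \<in> stacks A"
  by (cases A) auto

lemma cand_sn: "M \<in> cand A \<Longrightarrow> sn M"
  using candD[of M A "[]"] by simp

lemma stacks_Imp: "\<pi> \<in> stacks (Imp A B) \<longleftrightarrow>
    \<pi> = [] \<or> (\<exists>N \<kappa>. \<pi> = Arg N # \<kappa> \<and> N \<in> cand A \<and> \<kappa> \<in> stacks B)"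
  by (auto simp: cand_def)

lemma stacks_Disj: "\<pi> \<in> stacks (Disj A B) \<longleftrightarrow>
    \<pi> = [] \<or> (\<exists>N1 N2 \<kappa>. \<pi> = Case N1 N2 # \<kappa> \<and>
      (\<forall>P \<in> cand A. sn (subst N1 P 0 \<star> \<kappa>)) \<and> (\<forall>P \<in> cand B. sn (subst N2 P 0 \<star> \<kappa>)))"
  by (auto simp: cand_def)

lemma stacks_sn: "\<pi> \<in> stacks A \<Longrightarrow> sn_stack \<pi>"
proof (induction A arbitrary: \<pi>)
  case (Imp A B)
  then show ?case
    by (auto simp: stacks_Imp simp del: stacks.simps intro: sn_stack_Nil sn_stack_Arg cand_sn)
next
  case (Conj A B)
  then show ?case by (auto intro: sn_stack_Nil sn_stack_Pi)
next
  case (Disj A B)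
  \<comment> \<open>The branches are instantiated with this variable; \<open>sn_substD\<close> then
    yields the open branches under the lifted tail, as required by
    \<open>sn_stack_Case\<close>.\<close>
  have "Var 0 \<in> cand A" "Var 0 \<in> cand B"
    using Disj.IH by (auto simp: cand_def intro: sn_Var_app_stack)
  with Disj.prems show ?case
    by (auto simp: stacks_Disj simp del: stacks.simps intro!: sn_stack_Nil sn_stack_Case
        intro: sn_substD[of _ "Var 0" 0] simp: subst_app_stack_lift)
qed (auto intro: sn_stack_Nil)

lemma Var_in_cand: "Var i \<in> cand A"
  by (auto simp: cand_def intro: sn_Var_app_stack stacks_sn)

text \<open>
  Identifying all classical indices with their predecessors undoes the lifting of \<open>\<sigma>\<close> and \<open>\<rho>\<close>;
  strong normalizability is reflected even by such non-injective renamings. So the candidates need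
  not be closed under renaming.
\<close>

lemma csubst_stack_sn:
  assumes "sn (psub M \<sigma> (ccons (0, \<pi>) \<rho>))"
  shows "sn (csubst_stack (psub M (cups \<sigma>) (cupr \<rho>)) \<pi>)"
proof -
  \<comment> \<open>Subtraction truncates, so the name 0 is kept. This is why the name paired with
    \<open>\<pi>\<close> in the assumption is 0.\<close>
  let ?pred = "\<lambda>a. a - Suc 0"
  have "?pred \<circ> Suc = id" "id \<circ> id = id" by auto
  then have p: "ren (ren N id Suc) id ?pred = N" "ren_elim (ren_elim e id Suc) id ?pred = e" for N e
    by (simp_all only: ren_ren ren_id comp_id)
  have 1: "ren_isub (cups \<sigma>) id ?pred = \<sigma>"
    by (rule ext) (simp add: ren_isub_def cups_def p)
  have "ren_csub (ccons (0, ren_stack \<pi> id Suc) (\<lambda>a. cupr \<rho> (Suc a))) id ?pred a = ccons (0, \<pi>) \<rho> a" for a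
    by (cases a) (simp_all add: ren_csub_def ccons_def cupr_simps p comp_def)
  then have 2: "ren_csub (ccons (0, ren_stack \<pi> id Suc) (\<lambda>a. cupr \<rho> (Suc a))) id ?pred = ccons (0, \<pi>) \<rho>" ..
  have "ren (csubst_stack (psub M (cups \<sigma>) (cupr \<rho>)) \<pi>) id ?pred = psub M \<sigma> (ccons (0, \<pi>) \<rho>)"
    by (subst csubst_psub_cupr, subst ren_psub) (simp only: 1 2)
  with assms show ?thesis by (metis sn_renD)
qed

text \<open>Only the stacks assigned to classical variables are constrained, not their names:
  \<open>(a M)\<close> is normalizable for any name as soon as \<open>M\<close> is. This permits the
  identification of names made for \<mu>.\<close>

definition adequate :: "'p decls \<Rightarrow> 'p decls \<Rightarrow> isub \<Rightarrow> csub \<Rightarrow> bool" where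
  "adequate \<Gamma> \<Delta> \<sigma> \<rho> \<longleftrightarrow> (\<forall>x A. \<Gamma> x = Some A \<longrightarrow> \<sigma> x \<in> cand A) \<and>
     (\<forall>a A. \<Delta> a = Some A \<longrightarrow> snd (\<rho> a) \<in> stacks A)"

lemma adequate_mono:
  assumes "adequate \<Gamma> \<Delta> \<sigma> \<rho>" "\<Gamma>' \<subseteq>\<^sub>m \<Gamma>" "\<Delta>' \<subseteq>\<^sub>m \<Delta>"
  shows "adequate \<Gamma>' \<Delta>' \<sigma> \<rho>"
  using assms unfolding adequate_def map_le_def by (metis domI)

lemma compatible_iff:
  "compatible \<Gamma>1 \<Gamma>2 \<longleftrightarrow> (\<forall>x A B. \<Gamma>1 x = Some A \<longrightarrow> \<Gamma>2 x = Some B \<longrightarrow> A = B)"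
proof
  assume "compatible \<Gamma>1 \<Gamma>2"
  then show "\<forall>x A B. \<Gamma>1 x = Some A \<longrightarrow> \<Gamma>2 x = Some B \<longrightarrow> A = B"
    unfolding compatible_def by (metis IntI domI option.inject)
next
  assume *: "\<forall>x A B. \<Gamma>1 x = Some A \<longrightarrow> \<Gamma>2 x = Some B \<longrightarrow> A = B"
  show "compatible \<Gamma>1 \<Gamma>2"
    unfolding compatible_def
  proof
    fix x assume "x \<in> dom \<Gamma>1 \<inter> dom \<Gamma>2"
    then obtain A B where "\<Gamma>1 x = Some A" "\<Gamma>2 x = Some B" by blast
    with * show "\<Gamma>1 x = \<Gamma>2 x" by simp
  qed
qed

text \<open>The right summand of \<open>++\<close> overrides the left one and is always contained in
  the sum; the left one is contained because the two agree where they overlap.\<close>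

lemma compatible_map_le: "compatible \<Gamma>1 \<Gamma>2 \<Longrightarrow> \<Gamma>1 \<subseteq>\<^sub>m \<Gamma>1 ++ \<Gamma>2"
  by (auto simp: compatible_iff map_le_def map_add_def split: option.split)

lemma compatible_map_add:
  "compatible \<Gamma> \<Gamma>2 \<Longrightarrow> compatible \<Gamma>1 \<Gamma>2 \<Longrightarrow> compatible (\<Gamma> ++ \<Gamma>1) \<Gamma>2"
  by (auto simp: compatible_iff map_add_def split: option.split)

lemma adequate_icons:
  "adequate \<Gamma> \<Delta> \<sigma> \<rho> \<Longrightarrow> P \<in> cand A \<Longrightarrow> adequate (extend A \<Gamma>) \<Delta> (icons P \<sigma>) \<rho>"
  by (auto simp: adequate_def extend_def icons_def split: nat.splits)

lemma adequate_ccons: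
  "adequate \<Gamma> \<Delta> \<sigma> \<rho> \<Longrightarrow> \<pi> \<in> stacks A \<Longrightarrow> adequate \<Gamma> (extend A \<Delta>) \<sigma> (ccons (b, \<pi>) \<rho>)"
  by (auto simp: adequate_def extend_def ccons_def split: nat.splits)

text \<open>The substitutions are arbitrary in the induction because abstraction and case branches
  extend \<open>\<sigma>\<close> and \<mu> extends \<open>\<rho>\<close>. A premise typed in part of
  a context is handled by restricting adequacy to that part.\<close>

lemma typing_cand:
  assumes "\<Gamma> \<parallel> \<Delta> \<turnstile> M : A" "adequate \<Gamma> \<Delta> \<sigma> \<rho>"
  shows "psub M \<sigma> \<rho> \<in> cand A"
  using assms
proof (induction arbitrary: \<sigma> \<rho> rule: typing.induct)
  case (Var \<Gamma> x A \<Delta>)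
  then show ?case by (simp add: adequate_def)
next
  case (Pair \<Gamma>1 \<Delta>1 M A \<Gamma>2 \<Delta>2 N B)
  then have M: "psub M \<sigma> \<rho> \<in> cand A" and N: "psub N \<sigma> \<rho> \<in> cand B"
    by (meson adequate_mono compatible_map_le map_le_map_add)+
  show ?case
    by (rule candI) (use cand_sn[OF M] cand_sn[OF N] candD[OF M] candD[OF N] sn_proj in
        \<open>auto simp del: foldl_Cons intro: sn_Pair\<close>)
next
  case (Pi1 \<Gamma> \<Delta> M A1 A2)
  then show ?case
    by (intro candI) (use candD[of "psub M \<sigma> \<rho>" "Conj A1 A2" "Pi1 # _"] in auto)
next
  case (Pi2 \<Gamma> \<Delta> M A1 A2)
  then show ?case
    by (intro candI) (use candD[of "psub M \<sigma> \<rho>" "Conj A1 A2" "Pi2 # _"] in auto)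
next
  case (Lam A \<Gamma> \<Delta> M B)
  let ?M = "psub M (ups \<sigma>) (upr \<rho>)"
  have M: "subst ?M P 0 \<in> cand B" if "P \<in> cand A" for P
    using Lam.IH[OF adequate_icons[OF Lam.prems that]] by (simp add: subst_psub_ups)
  \<comment> \<open>For the empty stack the body itself must be normalizable; this follows by
    instantiating it with a variable, which lies in every candidate.\<close>
  have "sn ?M" by (rule sn_substD, rule cand_sn, rule M, rule Var_in_cand)
  then show ?case
    by (intro candI) (auto simp: stacks_Imp simp del: stacks.simps foldl_Cons
        intro: sn_Lam sn_beta candD[OF M] cand_sn)
next
  case (Arg \<Gamma>1 \<Delta>1 M A B \<Gamma>2 \<Delta>2 N)
  then have M: "psub M \<sigma> \<rho> \<in> cand (Imp A B)" and N: "psub N \<sigma> \<rho> \<in> cand A"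
    by (meson adequate_mono compatible_map_le map_le_map_add)+
  then show ?case
    by (intro candI) (use candD[OF M, of "Arg (psub N \<sigma> \<rho>) # _"] in
        \<open>simp add: stacks_Imp del: stacks.simps\<close>)
next
  case (Inj1 \<Gamma> \<Delta> M A1 A2)
  then have M: "psub M \<sigma> \<rho> \<in> cand A1" by blast
  show ?case
  proof (rule candI)
    fix \<pi> assume \<pi>: "\<pi> \<in> stacks (Disj A1 A2)"
    then show "sn (psub (Inj1 M) \<sigma> \<rho> \<star> \<pi>)"
      using M cand_sn[OF M] stacks_sn[OF \<pi>]
      by (auto simp: stacks_Disj simp del: stacks.simps foldl_Cons intro: sn_Inj1 sn_case)
  qed
next
  case (Inj2 \<Gamma> \<Delta> M A2 A1)
  then have M: "psub M \<sigma> \<rho> \<in> cand A2" by blast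
  show ?case
  proof (rule candI)
    fix \<pi> assume \<pi>: "\<pi> \<in> stacks (Disj A1 A2)"
    then show "sn (psub (Inj2 M) \<sigma> \<rho> \<star> \<pi>)"
      using M cand_sn[OF M] stacks_sn[OF \<pi>]
      by (auto simp: stacks_Disj simp del: stacks.simps foldl_Cons intro: sn_Inj2 sn_case)
  qed
next
  case (Case \<Gamma> \<Delta> M A1 A2 \<Gamma>1 \<Delta>1 N1 C \<Gamma>2 \<Delta>2 N2)
  have "\<Gamma> \<subseteq>\<^sub>m \<Gamma> ++ \<Gamma>1 ++ \<Gamma>2" "\<Gamma>1 \<subseteq>\<^sub>m \<Gamma> ++ \<Gamma>1 ++ \<Gamma>2"
    "\<Delta> \<subseteq>\<^sub>m \<Delta> ++ \<Delta>1 ++ \<Delta>2" "\<Delta>1 \<subseteq>\<^sub>m \<Delta> ++ \<Delta>1 ++ \<Delta>2"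
    by (meson Case.hyps compatible_map_le compatible_map_add map_le_map_add map_le_trans)+
  then have a: "adequate \<Gamma> \<Delta> \<sigma> \<rho>" "adequate \<Gamma>1 \<Delta>1 \<sigma> \<rho>" "adequate \<Gamma>2 \<Delta>2 \<sigma> \<rho>"
    using adequate_mono[OF Case.prems] map_le_map_add by blast+
  let ?N1 = "psub N1 (ups \<sigma>) (upr \<rho>)" and ?N2 = "psub N2 (ups \<sigma>) (upr \<rho>)"
  have M: "psub M \<sigma> \<rho> \<in> cand (Disj A1 A2)" using Case.IH(1) a(1) .
  have N1: "subst ?N1 P 0 \<in> cand C" if "P \<in> cand A1" for P
    using Case.IH(2)[OF adequate_icons[OF a(2) that]] by (simp add: subst_psub_ups)
  have N2: "subst ?N2 P 0 \<in> cand C" if "P \<in> cand A2" for P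
    using Case.IH(3)[OF adequate_icons[OF a(3) that]] by (simp add: subst_psub_ups)
  show ?case
  proof (rule candI)
    fix \<pi> assume "\<pi> \<in> stacks C"
    \<comment> \<open>The case eliminator joins the stack of \<open>C\<close>, and the induction
      hypothesis for \<open>M\<close> is used at this longer stack.\<close>
    then have "Case ?N1 ?N2 # \<pi> \<in> stacks (Disj A1 A2)"
      using N1 N2 by (auto simp: stacks_Disj simp del: stacks.simps intro: candD)
    from candD[OF M this] show "sn (psub (App M (Case N1 N2)) \<sigma> \<rho> \<star> \<pi>)" by simp
  qed
next
  case (Mu \<Gamma> A \<Delta> M)
  show ?case
  proof (rule candI)
    fix \<pi> assume \<pi>: "\<pi> \<in> stacks A"
    \<comment> \<open>Since \<open>M\<close> has type \<open>Bot\<close>, it is used with the empty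
      stack only; \<open>\<pi>\<close> enters as the interpretation of the bound name.\<close>
    then have "sn (psub M \<sigma> (ccons (0, \<pi>) \<rho>))"
      by (intro cand_sn[OF Mu.IH] adequate_ccons Mu.prems)
    then show "sn (psub (Mu M) \<sigma> \<rho> \<star> \<pi>)"
      using stacks_sn[OF \<pi>] by (simp add: csubst_stack_sn sn_mu)
  qed
next
  case (Named \<Delta> a A \<Gamma> M)
  then have "psub M \<sigma> \<rho> \<in> cand A" "snd (\<rho> a) \<in> stacks A"
    by (auto simp: adequate_def)
  then show ?case by (simp add: cand_def sn_Named)
qed

section \<open>From accessibility to the absence of infinite reductions\<close>

lemma accp_strongly_normalizable:
  assumes "Wellfounded.accp (\<lambda>y x. R x y) x"
  shows "strongly_normalizable R x"
  unfolding strongly_normalizable_def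
proof
  assume "\<exists>f. f 0 = x \<and> (\<forall>i. R (f i) (f (Suc i)))"
  with assms show False
  proof (induction rule: accp_induct_rule)
    case (1 x)
    then obtain f where f: "f 0 = x" "\<forall>i. R (f i) (f (Suc i))" by blast
    have "R x (f (Suc 0))"
      using f by metis
    moreover have "\<exists>g. g 0 = f (Suc 0) \<and> (\<forall>i. R (g i) (g (Suc i)))"
      by (rule exI[of _ "\<lambda>i. f (Suc i)"]) (simp add: f(2))
    ultimately show False by (rule 1(2))
  qed
qed

theorem theorem2p2:
  fixes \<Gamma> \<Delta> :: "'p decls" and M :: trm and A :: "'p form"
  assumes "\<Gamma> \<parallel> \<Delta> \<turnstile> M : A"
  shows "strongly_normalizable (\<triangleright>) M"
proof -
  \<comment> \<open>Every candidate contains the variables and every set of stacks the empty one, so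
    the identity substitution is adequate for any context.\<close>
  have "adequate \<Gamma> \<Delta> Var idc"
    by (simp add: adequate_def Var_in_cand)
  then have "M \<in> cand A"
    using typing_cand[OF assms, of Var idc] by simp
  then show ?thesis
    by (intro accp_strongly_normalizable cand_sn)
qed

end
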